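(* For all $n\geq1$, \[ P_{n}^{(\mathrm{pk},\mathrm{ides})}(s,t) =\frac{1}{n!}\sum_{k=0}^n d(n,k)\left((1-s)^{1/2}(1-t)\right)^{n-k}P_{k}^{\mathrm{pk}}(s)A_{k}(t), \] where $P_{n}^{(\mathrm{pk},\mathrm{ides})}(s,t)=\sum_{\pi\in\mathfrak{S}_{n}}s^{\mathrm{pk}(\pi)+1}t^{\mathrm{ides}(\pi)+1}$.
   Context: $\mathfrak{S}_n$ is the symmetric group on $[n]$. For $\pi\in\mathfrak{S}_n$, $i\in[n-1]$ is a descent if $\pi(i)>\pi(i+1)$, $\mathrm{des}(\pi)$ is the number of descents, $\mathrm{ides}(\pi)=\mathrm{des}(\pi^{-1})$; an index $i$ with $2\le i\le n-1$ is a peak if $\pi(i-1)<\pi(i)>\pi(i+1)$ and $\mathrm{pk}(\pi)$ is the number of peaks. $A_n(t)=\sum_{\pi\in\mathfrak{S}_n}t^{\mathrm{des}(\pi)+1}$ and $P_n^{\mathrm{pk}}(t)=\sum_{\pi\in\mathfrak{S}_n}t^{\mathrm{pk}(\pi)+1}$ for $n\ge1$, with $A_0(t)=P_0^{\mathrm{pk}}(t)=1$. $d(n,k)$ is the number of permutations in $\mathfrak{S}_n$ with exactly $k$ cycles, all of odd length (with $d(0,0)=1$); note $d(n,k)=0$ when $n-k$ is odd. *)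

theory Defs
  imports Complex_Main "HOL-Combinatorics.Permutations" "HOL-Combinatorics.Orbits"
begin

definition sym_group :: "nat \<Rightarrow> (nat \<Rightarrow> nat) set" where
  "sym_group n = {\<pi>. \<pi> permutes {1..n}}"

definition des :: "nat \<Rightarrow> (nat \<Rightarrow> nat) \<Rightarrow> nat" where
  "des n \<pi> = card {i. 1 \<le> i \<and> i < n \<and> \<pi> i > \<pi> (i + 1)}"

definition ides :: "nat \<Rightarrow> (nat \<Rightarrow> nat) \<Rightarrow> nat" where
  "ides n \<pi> = des n (inv \<pi>)"

definition pk :: "nat \<Rightarrow> (nat \<Rightarrow> nat) \<Rightarrow> nat" where
  "pk n \<pi> = card {i. 2 \<le> i \<and> i < n \<and> \<pi> (i - 1) < \<pi> i \<and> \<pi> i > \<pi> (i + 1)}"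

text \<open>Polynomials are represented by their values at arbitrary elements of a commutative ring.\<close>

definition eulerian_poly :: "nat \<Rightarrow> 'a::comm_ring_1 \<Rightarrow> 'a" where
  "eulerian_poly n t = (if n = 0 then 1 else \<Sum>\<pi>\<in>sym_group n. t ^ (des n \<pi> + 1))"

definition peak_poly :: "nat \<Rightarrow> 'a::comm_ring_1 \<Rightarrow> 'a" where
  "peak_poly n t = (if n = 0 then 1 else \<Sum>\<pi>\<in>sym_group n. t ^ (pk n \<pi> + 1))"

definition pk_ides_poly :: "nat \<Rightarrow> 'a::comm_ring_1 \<Rightarrow> 'a \<Rightarrow> 'a" where
  "pk_ides_poly n s t = (\<Sum>\<pi>\<in>sym_group n. s ^ (pk n \<pi> + 1) * t ^ (ides n \<pi> + 1))"

text \<open>Each cycle is identified with its underlying set, so its length is a cardinality; fixed points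
  are cycles of length 1.\<close>

definition cycles_of :: "nat \<Rightarrow> (nat \<Rightarrow> nat) \<Rightarrow> nat set set" where
  "cycles_of n \<pi> = orbit \<pi> ` {1..n}"

definition odd_cycle_number :: "nat \<Rightarrow> nat \<Rightarrow> nat" where
  "odd_cycle_number n k =
     card {\<pi> \<in> sym_group n. card (cycles_of n \<pi>) = k \<and> (\<forall>c\<in>cycles_of n \<pi>. odd (card c))}"

end

theory Submission
  imports Defs "HOL-Computational_Algebra.Polynomial_FPS"
begin

text \<open>
  Counting the words \<open>w\<close> of length \<open>n\<close> over a \<open>k\<close>-letter alphabet by their peaks, and grouping them
  by standardization, gives \<open>W k n = (\<Sum>\<pi>. s ^ (pk \<pi> + 1) * (k + n - 1 - ides \<pi> choose n))\<close>, so
  \<open>(1 - t) ^ (n + 1) * (\<Sum>k. W k n * t ^ k)\<close> is the left-hand side of the theorem.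
  Splitting a word at the last occurrence of its largest letter yields a Moebius recursion in \<open>k\<close>
  for \<open>U k = (\<Sum>n. W k n * z ^ n)\<close>, from which induction on \<open>k\<close> gives the Riccati equation
  \<open>(1 - r\<^sup>2 z\<^sup>2) U' = k (U\<^sup>2 - r\<^sup>2)\<close>.
  Since \<open>W k n\<close> is a polynomial in \<open>k\<close> with leading coefficient \<open>P n / n!\<close>, where \<open>P n\<close> is the peak
  polynomial, comparing leading coefficients shows that \<open>P(x) = (\<Sum>n. P n * x ^ n / n!)\<close> satisfies
  \<open>P' = P\<^sup>2 - r\<^sup>2\<close>. Hence \<open>U k = P(k M)\<close> with \<open>M = artanh (r z) / r\<close>, and the powers
  of \<open>M\<close> enumerate permutations with odd cycles. Summing \<open>k ^ m * t ^ k\<close> over \<open>k\<close> produces the Eulerian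
  polynomials.
\<close>

unbundle fps_syntax

subsection \<open>Permutations with odd cycles\<close>

text \<open>Stated over an arbitrary set because the recurrence removes arbitrary points, which
  leaves sets other than \<open>{1..n}\<close>.\<close>

definition odd_cycle_perms :: "'a set \<Rightarrow> nat \<Rightarrow> ('a \<Rightarrow> 'a) set" where
  "odd_cycle_perms A m =
     {\<pi>. \<pi> permutes A \<and> card (orbit \<pi> ` A) = m \<and> (\<forall>c\<in>orbit \<pi> ` A. odd (card c))}"

lemma odd_cycle_number_eq: "odd_cycle_number n m = card (odd_cycle_perms {1..n} m)"
  unfolding odd_cycle_number_def odd_cycle_perms_def sym_group_def cycles_of_def
  by (rule arg_cong[where f = card]) auto

lemma finite_odd_cycle_perms: "finite A \<Longrightarrow> finite (odd_cycle_perms A m)"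
  by (rule finite_subset[OF _ finite_permutations[of A]]) (auto simp: odd_cycle_perms_def)

text \<open>The permutation \<open>\<sigma>(c := x, x := a, a := \<sigma> c)\<close> inserts \<open>x, a\<close> after \<open>c\<close> into its cycle, which
  preserves the number of cycles and the parities of their lengths.\<close>

lemma permutes_insert_pair:
  assumes "\<sigma> permutes B" "c \<in> B" "x \<notin> B" "a \<notin> B" "x \<noteq> a"
  shows "\<sigma>(c := x, x := a, a := \<sigma> c) permutes insert x (insert a B)"
proof -
  have "\<sigma> x = x" "\<sigma> a = a" using assms by (auto simp: permutes_def)
  \<comment> \<open>Insertion is composition with a 3-cycle, written as two transpositions.\<close>
  then have eq: "\<sigma>(c := x, x := a, a := \<sigma> c) = \<sigma> \<circ> (transpose c a \<circ> transpose c x)"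
    using assms by (auto simp: fun_eq_iff transpose_def)
  show ?thesis unfolding eq
    using assms by (intro permutes_compose permutes_swap_id) (auto intro: permutes_subset)
qed

text \<open>Splicing changes only the cycle through \<open>c\<close>, which gains \<open>x\<close>
  and \<open>a\<close>. On every other cycle \<open>\<pi>\<close> and \<open>\<sigma>\<close>
  agree.\<close>

lemma orbits_insert_pair:
  assumes \<sigma>: "\<sigma> permutes B" and B: "finite B" "c \<in> B" "x \<notin> B" "a \<notin> B" "x \<noteq> a"
  defines "\<pi> \<equiv> \<sigma>(c := x, x := a, a := \<sigma> c)"
  shows "orbit \<pi> ` insert x (insert a B) =
    insert (insert x (insert a (orbit \<sigma> c))) (orbit \<sigma> ` B - {orbit \<sigma> c})"
proof -
  have \<pi>p: "\<pi> permutes insert x (insert a B)"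
    unfolding \<pi>_def using assms by (intro permutes_insert_pair) auto
  have \<pi>perm: "permutation \<pi>"
    by (rule permutes_imp_permutation[OF _ \<pi>p]) (simp add: \<open>finite B\<close>)
  have \<sigma>perm: "permutation \<sigma>" by (rule permutes_imp_permutation[OF \<open>finite B\<close> \<sigma>])
  have \<sigma>B: "orbit \<sigma> y \<subseteq> B" if "y \<in> B" for y
    using permutes_orbit_subset[OF \<sigma> that] .
  have \<pi>_eq: "\<pi> c = x" "\<pi> x = a" "\<pi> a = \<sigma> c" "\<And>y. y \<in> B \<Longrightarrow> y \<noteq> c \<Longrightarrow> \<pi> y = \<sigma> y"
    using B by (auto simp: \<pi>_def)
  have cc: "c \<in> orbit \<pi> c" using \<pi>perm by (rule permutation_self_in_orbit)
  have xc: "x \<in> orbit \<pi> c" using orbit.base[of \<pi> c] \<pi>_eq by simp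
  have ac: "a \<in> orbit \<pi> c" using orbit.step[OF xc] \<pi>_eq by simp
  have sc: "\<sigma> c \<in> orbit \<pi> c" using orbit.step[OF ac] \<pi>_eq by simp
  have big: "orbit \<pi> c = insert x (insert a (orbit \<sigma> c))"
  proof (intro equalityI subsetI)
    fix y assume "y \<in> orbit \<pi> c"
    then show "y \<in> insert x (insert a (orbit \<sigma> c))"
    proof induction
      case base then show ?case using \<pi>_eq by simp
    next
      case (step y)
      then consider "y = x" | "y = a" | "y = c" | "y \<in> orbit \<sigma> c" "y \<noteq> c" by auto
      then show ?case
      proof cases
        case 4
        then have "y \<in> B" using \<sigma>B B by auto
        with 4 show ?thesis using \<pi>_eq by (auto intro: orbit.step)
      qed (auto simp: \<pi>_eq orbit.base)
    qed
  next
    fix y assume "y \<in> insert x (insert a (orbit \<sigma> c))"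
    moreover have "y \<in> orbit \<pi> c" if "y \<in> orbit \<sigma> c" for y
      using that
    proof induction
      case base then show ?case by (rule sc)
    next
      case (step y)
      then have "y \<in> B" using \<sigma>B B by auto
      with step show ?case using \<pi>_eq(4)[of y] sc orbit.step[of y \<pi> c] by (cases "y = c") auto
    qed
    ultimately show "y \<in> orbit \<pi> c" using xc ac by auto
  qed
  have same: "orbit \<pi> y = orbit \<pi> c" if "y \<in> orbit \<pi> c" for y
    using that cc by (auto intro: orbit_trans orbit_swap)
  have other: "orbit \<pi> y = orbit \<sigma> y" if "y \<in> B" "y \<notin> orbit \<sigma> c" for y
  proof -
    have "c \<notin> orbit \<sigma> y"
      using that orbit_swap permutation_self_in_orbit[OF \<sigma>perm] by metis
    then have "\<pi> z = \<sigma> z" if "z \<in> orbit \<sigma> y" for z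
      using that \<sigma>B[OF \<open>y \<in> B\<close>] \<pi>_eq by auto
    then have "orbit \<sigma> y = orbit \<pi> y"
      by (intro orbit_cong0[of y "orbit \<sigma> y"])
        (auto intro: permutation_self_in_orbit[OF \<sigma>perm] orbit.step)
    then show ?thesis by simp
  qed
  have \<sigma>same: "orbit \<sigma> y = orbit \<sigma> c \<longleftrightarrow> y \<in> orbit \<sigma> c" for y
    using permutation_self_in_orbit[OF \<sigma>perm] by (metis orbit_trans orbit_swap subsetI equalityI)
  have 1: "orbit \<pi> ` {y \<in> B. y \<in> orbit \<sigma> c} = {orbit \<pi> c}"
    using same big \<open>c \<in> B\<close> permutation_self_in_orbit[OF \<sigma>perm, of c] by auto
  have 2: "orbit \<pi> ` {y \<in> B. y \<notin> orbit \<sigma> c} = orbit \<sigma> ` B - {orbit \<sigma> c}"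
    using other \<sigma>same by (auto simp: image_iff)
  have "insert x (insert a B) = {x, a} \<union> {y \<in> B. y \<in> orbit \<sigma> c} \<union> {y \<in> B. y \<notin> orbit \<sigma> c}"
    by auto
  then have "orbit \<pi> ` insert x (insert a B) =
      {orbit \<pi> x, orbit \<pi> a} \<union> {orbit \<pi> c} \<union> (orbit \<sigma> ` B - {orbit \<sigma> c})"
    using 1 2 by (simp only: image_Un) simp
  then show ?thesis using same xc ac big by auto
qed

lemma insert_pair_odd_cycle_perms_iff:
  assumes \<sigma>: "\<sigma> permutes B" and B: "finite B" "c \<in> B" "x \<notin> B" "a \<notin> B" "x \<noteq> a"
  shows "\<sigma>(c := x, x := a, a := \<sigma> c) \<in> odd_cycle_perms (insert x (insert a B)) m \<longleftrightarrow>
    \<sigma> \<in> odd_cycle_perms B m"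
proof -
  let ?C = "orbit \<sigma> c" and ?D = "insert x (insert a (orbit \<sigma> c))"
  have sub: "orbit \<sigma> y \<subseteq> B" if "y \<in> B" for y
    using permutes_orbit_subset[OF \<sigma> that] .
  have C: "finite ?C" "x \<notin> ?C" "a \<notin> ?C" using sub B by (auto intro: finite_subset)
  \<comment> \<open>The enlarged cycle contains \<open>x\<close>, which lies outside
    \<open>B\<close>, so it is none of the old cycles and replacing \<open>?C\<close> by it keeps
    their number.\<close>
  have D: "?D \<notin> orbit \<sigma> ` B" using sub B by blast
  have "card (insert ?D (orbit \<sigma> ` B - {?C})) = card (orbit \<sigma> ` B)"
    using D B card_Suc_Diff1[of "orbit \<sigma> ` B" ?C] by simp
  moreover have "odd (card ?D) \<longleftrightarrow> odd (card ?C)" using C B by simp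
  moreover have "?C \<in> orbit \<sigma> ` B" using B by auto
  ultimately show ?thesis
    unfolding odd_cycle_perms_def mem_Collect_eq orbits_insert_pair[OF assms]
    using \<sigma> permutes_insert_pair[OF \<sigma> B(2-)] by auto
qed

text \<open>A fixed point \<open>x\<close> is an odd cycle by itself; dropping it leaves a
  permutation of \<open>A\<close> with one cycle fewer.\<close>

lemma odd_cycle_perms_fix:
  assumes "finite A" "x \<notin> A"
  shows "{\<pi> \<in> odd_cycle_perms (insert x A) m. \<pi> x = x} =
    (if m = 0 then {} else odd_cycle_perms A (m - 1))"
proof -
  have perm: "\<pi> permutes insert x A \<and> \<pi> x = x \<longleftrightarrow> \<pi> permutes A" for \<pi>
    using assms by (auto simp: permutes_not_in intro: permutes_subset permutes_superset)
  have orb: "orbit \<pi> ` insert x A = insert {x} (orbit \<pi> ` A)" "{x} \<notin> orbit \<pi> ` A"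
    if "\<pi> permutes A" for \<pi>
  proof -
    have "orbit \<pi> x = {x}" using that assms by (simp add: orbit_eq_singleton_iff permutes_not_in)
    then show "orbit \<pi> ` insert x A = insert {x} (orbit \<pi> ` A)" by simp
    show "{x} \<notin> orbit \<pi> ` A" using permutes_orbit_subset[OF that] assms by blast
  qed
  have "\<pi> \<in> odd_cycle_perms (insert x A) m \<and> \<pi> x = x \<longleftrightarrow>
      m \<noteq> 0 \<and> \<pi> \<in> odd_cycle_perms A (m - 1)" for \<pi>
  proof (cases "\<pi> permutes A")
    case True
    then show ?thesis using perm[of \<pi>] orb[of \<pi>] assms
      unfolding odd_cycle_perms_def mem_Collect_eq
      by (simp only: orb(1)[OF True] ball_simps card_insert_disjoint finite_imageI) auto
  next
    case False
    then show ?thesis using perm[of \<pi>] by (auto simp: odd_cycle_perms_def)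
  qed
  then show ?thesis by auto
qed

text \<open>A moved \<open>x\<close> lies on an odd cycle of length at least 3. So its predecessor
  \<open>c\<close> and its successor \<open>a\<close> are distinct, and cutting \<open>x\<close> and
  \<open>a\<close> out of the cycle undoes the insertion.\<close>

lemma bij_betw_insert_pair:
  assumes A: "finite A" "x \<notin> A"
  shows "bij_betw (\<lambda>(a, c, \<sigma>). \<sigma>(c := x, x := a, a := \<sigma> c))
    (SIGMA a:A. (A - {a}) \<times> odd_cycle_perms (A - {a}) m)
    {\<pi> \<in> odd_cycle_perms (insert x A) m. \<pi> x \<noteq> x}"
    (is "bij_betw ?f ?S ?T")
proof (rule bij_betw_imageI)
  show "inj_on ?f ?S"
  proof (rule inj_onI)
    fix p q assume "p \<in> ?S" "q \<in> ?S" and f_eq: "?f p = ?f q"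
    then obtain a c \<sigma> a' c' \<sigma>' where pq: "p = (a, c, \<sigma>)" "q = (a', c', \<sigma>')"
      and *: "a \<in> A" "c \<in> A" "c \<noteq> a" "a' \<in> A" "c' \<in> A" "c' \<noteq> a'"
      and \<sigma>: "\<sigma> \<in> odd_cycle_perms (A - {a}) m" "\<sigma>' \<in> odd_cycle_perms (A - {a'}) m"
      by (elim SigmaE) blast
    have eq: "\<sigma>(c := x, x := a, a := \<sigma> c) = \<sigma>'(c' := x, x := a', a' := \<sigma>' c')"
      using f_eq by (simp add: pq)
    have p: "\<sigma> permutes A - {a}" "\<sigma>' permutes A - {a'}"
      using \<sigma> by (auto simp: odd_cycle_perms_def)
    have [simp]: "\<sigma> x = x" "\<sigma>' x = x" "\<sigma> a = a" "\<sigma>' a' = a'"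
      using p A by (auto simp: permutes_not_in)
    have ne: "a \<noteq> x" "a' \<noteq> x" "c \<noteq> x" "c' \<noteq> x" using * A by auto
    \<comment> \<open>The value at \<open>x\<close> reveals \<open>a\<close>, the preimage of
      \<open>x\<close> reveals \<open>c\<close>, and the remaining values reveal
      \<open>\<sigma>\<close>.\<close>
    have a: "a = a'" using fun_cong[OF eq, of x] ne by (auto split: if_splits)
    have inj: "\<sigma>' y \<noteq> x" if "y \<noteq> x" for y
      using that permutes_inj[OF p(2)] by (metis \<open>\<sigma>' x = x\<close> injD)
    have c: "c = c'" using fun_cong[OF eq, of c] ne * a inj by (auto split: if_splits)
    have "\<sigma> y = \<sigma>' y" for y
      using fun_cong[OF eq, of y] fun_cong[OF eq, of a] a c ne \<open>\<sigma> a = a\<close> \<open>\<sigma>' a' = a'\<close>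
      by (cases "y = c"; cases "y = x"; cases "y = a") auto
    then show "p = q" using a c pq by auto
  qed
  show "?f ` ?S = ?T"
  proof (intro equalityI subsetI)
    fix \<pi> assume "\<pi> \<in> ?f ` ?S"
    then obtain a c \<sigma> where *: "a \<in> A" "c \<in> A" "c \<noteq> a" "\<sigma> \<in> odd_cycle_perms (A - {a}) m"
      and \<pi>: "\<pi> = \<sigma>(c := x, x := a, a := \<sigma> c)" by auto
    have "insert x A = insert x (insert a (A - {a}))" using * by auto
    moreover have "\<pi> \<in> odd_cycle_perms (insert x (insert a (A - {a}))) m"
      unfolding \<pi>
      using * A by (subst insert_pair_odd_cycle_perms_iff) (auto simp: odd_cycle_perms_def)
    moreover have "\<pi> x \<noteq> x" using \<pi> * A by auto
    ultimately show "\<pi> \<in> ?T" by simp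
  next
    fix \<pi> assume "\<pi> \<in> ?T"
    then have p: "\<pi> permutes insert x A" and odd: "\<pi> \<in> odd_cycle_perms (insert x A) m"
      and ne: "\<pi> x \<noteq> x" by (auto simp: odd_cycle_perms_def)
    define a c where "a = \<pi> x" and "c = inv \<pi> x"
    have \<pi>c: "\<pi> c = x" unfolding c_def using p by (simp add: permutes_inverses)
    have aA: "a \<in> A" using permutes_in_image[OF p, of x] ne by (simp add: a_def)
    have cx: "c \<noteq> x"
    proof
      assume "c = x"
      with \<pi>c ne show False by simp
    qed
    have "\<pi> c \<in> insert x A" unfolding \<pi>c by simp
    then have cA: "c \<in> A" using cx unfolding permutes_in_image[OF p] by simp
    have ca: "c \<noteq> a"
    proof
      assume "c = a"
      \<comment> \<open>If \<open>c = a\<close>, then \<open>x\<close> and \<open>a\<close> form a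
        cycle of even length 2.\<close>
      have "orbit \<pi> x = {x, a}"
      proof -
        have "(\<pi> ^^ 2) x = x" using \<pi>c \<open>c = a\<close> by (simp add: numeral_2_eq_2 a_def)
        then have "orbit \<pi> x = {(\<pi> ^^ m) x |m. m < 2}" by (rule orbit_altdef_bounded) simp
        also have "\<dots> = (\<lambda>m. (\<pi> ^^ m) x) ` {0, 1}" 
          unfolding setcompr_eq_image by (rule arg_cong[where f = "image _"]) auto
        finally show ?thesis by (simp add: a_def)
      qed
      then have "even (card (orbit \<pi> x))" using ne by (simp add: a_def)
      moreover have "odd (card (orbit \<pi> x))" using odd by (auto simp: odd_cycle_perms_def)
      ultimately show False by simp
    qed
    \<comment> \<open>Bypass \<open>x\<close> and \<open>a\<close>: \<open>c\<close> inherits the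
      image of \<open>a\<close>, and both removed points become fixed.\<close>
    define \<sigma> where "\<sigma> = \<pi>(c := \<pi> a, x := x, a := a)"
    have ax: "a \<noteq> x" using aA A(2) by metis
    have \<pi>x: "\<pi> x = a" by (simp add: a_def)
    have "\<sigma> = \<pi> \<circ> (transpose c x \<circ> transpose c a)"
      using cx ca ax by (simp add: fun_eq_iff transpose_def \<sigma>_def \<pi>x \<pi>c)
    then have "\<sigma> permutes insert x A"
      using p aA cA by (simp add: permutes_compose permutes_swap_id)
    then have \<sigma>: "\<sigma> permutes A - {a}"
      by (rule permutes_superset) (auto simp: \<sigma>_def)
    have \<pi>: "\<pi> = \<sigma>(c := x, x := a, a := \<sigma> c)"
      using cx ca ax by (simp add: fun_eq_iff \<sigma>_def \<pi>x \<pi>c)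
    have "insert x A = insert x (insert a (A - {a}))" using aA by auto
    then have "\<sigma>(c := x, x := a, a := \<sigma> c) \<in> odd_cycle_perms (insert x (insert a (A - {a}))) m"
      using odd unfolding \<pi>[symmetric] by simp
    then have "\<sigma> \<in> odd_cycle_perms (A - {a}) m"
      using \<sigma> A aA cA ca by (subst (asm) insert_pair_odd_cycle_perms_iff) auto
    then have "(a, c, \<sigma>) \<in> ?S" using aA cA ca by auto
    then show "\<pi> \<in> ?f ` ?S" by (rule image_eqI[rotated]) (simp add: \<pi>[symmetric])
  qed
qed

text \<open>Either \<open>x\<close> is fixed, or there are \<open>card A\<close> choices for its
  image \<open>a\<close>, then \<open>card A - 1\<close> for its preimage \<open>c\<close>, and
  finally a permutation of \<open>A - {a}\<close>.\<close>

lemma card_odd_cycle_perms_insert: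
  assumes A: "finite A" "x \<notin> A"
  shows "card (odd_cycle_perms (insert x A) m) =
    (if m = 0 then 0 else card (odd_cycle_perms A (m - 1))) +
    (\<Sum>a\<in>A. (card A - 1) * card (odd_cycle_perms (A - {a}) m))"
proof -
  let ?P = "odd_cycle_perms (insert x A) m"
  have "?P = {\<pi> \<in> ?P. \<pi> x = x} \<union> {\<pi> \<in> ?P. \<pi> x \<noteq> x}" by auto
  then have "card ?P = card {\<pi> \<in> ?P. \<pi> x = x} + card {\<pi> \<in> ?P. \<pi> x \<noteq> x}"
    using finite_odd_cycle_perms[of "insert x A" m] A
    by (metis (no_types, lifting) card_Un_disjoint disjoint_iff finite_Un finite_insert mem_Collect_eq)
  also have "card {\<pi> \<in> ?P. \<pi> x \<noteq> x} =
      card (SIGMA a:A. (A - {a}) \<times> odd_cycle_perms (A - {a}) m)"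
    using bij_betw_same_card[OF bij_betw_insert_pair[OF A]] by simp
  also have "\<dots> = (\<Sum>a\<in>A. (card A - 1) * card (odd_cycle_perms (A - {a}) m))"
    using A by (subst card_SigmaI)
      (auto simp: finite_odd_cycle_perms card_cartesian_product intro!: sum.cong)
  finally show ?thesis using odd_cycle_perms_fix[OF A, of m] by simp
qed

lemma odd_cycle_perms_empty: "odd_cycle_perms {} m = (if m = 0 then {id} else {})"
  by (auto simp: odd_cycle_perms_def)

text \<open>Independence of the labels comes from the recurrence rather than from conjugation: by
  induction its right-hand side depends only on cardinalities, so \<open>A\<close> and
  \<open>{1..card A}\<close> give the same value.\<close>

lemma card_odd_cycle_perms:
  fixes A :: "nat set"
  assumes "finite A"
  shows "card (odd_cycle_perms A m) = odd_cycle_number (card A) m"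
  using assms
proof (induction "card A" arbitrary: A m rule: less_induct)
  case less
  show ?case
  proof (cases "card A")
    case 0
    then show ?thesis using less.prems
      by (auto simp: odd_cycle_number_eq odd_cycle_perms_empty)
  next
    case (Suc n)
    have step: "card (odd_cycle_perms (insert x B) m) =
        (if m = 0 then 0 else odd_cycle_number n (m - 1)) +
        n * ((n - 1) * odd_cycle_number (n - 1) m)"
      if B: "x \<notin> B" "card B = n" "finite B" for x :: nat and B
    proof -
      have "card (odd_cycle_perms B k) = odd_cycle_number n k" for k
        using less.hyps[of B k] B Suc by simp
      moreover have "card (odd_cycle_perms (B - {a}) m) = odd_cycle_number (n - 1) m"
        if "a \<in> B" for a
        using less.hyps[of "B - {a}" m] B Suc that by simp
      ultimately show ?thesis using B by (simp add: card_odd_cycle_perms_insert)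
    qed
    obtain x B where A: "A = insert x B" "x \<notin> B" "card B = n" "finite B"
      using Suc less.prems unfolding card_Suc_eq by auto
    have "{1..Suc n} = insert (Suc n) {1..n}" by auto
    then show ?thesis
      using step[OF A(2-4)] step[of "Suc n" "{1..n}"] A Suc by (simp add: odd_cycle_number_eq)
  qed
qed

lemma odd_cycle_number_0_left: "odd_cycle_number 0 m = (if m = 0 then 1 else 0)"
  by (simp add: odd_cycle_number_eq odd_cycle_perms_empty)

text \<open>At \<open>n = 0\<close> the factor \<open>n\<close> cancels the term with the truncated
  \<open>n - 1\<close>.\<close>

lemma odd_cycle_number_Suc:
  "odd_cycle_number (Suc n) m =
    (if m = 0 then 0 else odd_cycle_number n (m - 1)) +
    n * ((n - 1) * odd_cycle_number (n - 1) m)"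
proof -
  have "{1..Suc n} = insert (Suc n) {1..n}" by auto
  then have "odd_cycle_number (Suc n) m = card (odd_cycle_perms (insert (Suc n) {1..n}) m)"
    by (simp only: odd_cycle_number_eq)
  also have "\<dots> = (if m = 0 then 0 else odd_cycle_number n (m - 1)) +
      (\<Sum>a\<in>{1..n}. (n - 1) * odd_cycle_number (n - 1) m)"
    by (subst card_odd_cycle_perms_insert) (simp_all add: card_odd_cycle_perms)
  finally show ?thesis by simp
qed

lemma odd_cycle_number_eq_0: "n < m \<Longrightarrow> odd_cycle_number n m = 0"
proof (induction n arbitrary: m rule: less_induct)
  case (less n)
  then show ?case
    by (cases n) (auto simp: odd_cycle_number_0_left odd_cycle_number_Suc)
qed

subsection \<open>Peaks of words\<close>

definition words :: "nat \<Rightarrow> nat \<Rightarrow> nat list set" where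
  "words k n = {w. set w \<subseteq> {..<k} \<and> length w = n}"

text \<open>A peak is a weak ascent followed by a strict descent: with equal letters ranked from
  left to right, these are the peaks of the standardization.\<close>

fun list_pk :: "nat list \<Rightarrow> nat" where
  "list_pk (x # y # z # zs) = (if x \<le> y \<and> z < y then 1 else 0) + list_pk (y # z # zs)"
| "list_pk _ = 0"

text \<open>The empty word gets weight 1 instead of \<open>s\<close>, in line with
  \<open>peak_poly 0 s = 1\<close>.\<close>

definition weight :: "'a::comm_ring_1 \<Rightarrow> nat list \<Rightarrow> 'a" where
  "weight s w = (if w = [] then 1 else s ^ (list_pk w + 1))"

definition word_series :: "'a::comm_ring_1 \<Rightarrow> nat \<Rightarrow> 'a fps" where
  "word_series s k = Abs_fps (\<lambda>n. \<Sum>w\<in>words k n. weight s w)"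

lemma finite_words [simp]: "finite (words k n)"
  unfolding words_def by (rule finite_lists_length_eq) simp

lemma card_words: "card (words k n) = k ^ n"
  unfolding words_def by (subst card_lists_length_eq) auto

lemma words_0_right [simp]: "words k 0 = {[]}"
  by (auto simp: words_def)

lemma words_0_left: "n > 0 \<Longrightarrow> words 0 n = {}"
  by (auto simp: words_def)

lemma word_series_nth: "word_series s k $ n = (\<Sum>w\<in>words k n. weight s w)"
  by (simp add: word_series_def)

lemma word_series_nth_0 [simp]: "word_series s k $ 0 = 1"
  by (simp add: word_series_def weight_def)

lemma word_series_0: "word_series s 0 = 1"
  by (rule fps_ext) (auto simp: word_series_def words_0_left weight_def)

lemma list_pk_Cons_max: "\<forall>y\<in>set \<beta>. y < m \<Longrightarrow> list_pk (m # \<beta>) = list_pk \<beta>"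
proof -
  assume "\<forall>y\<in>set \<beta>. y < m"
  then show ?thesis by (cases \<beta> rule: list_pk.cases) auto
qed

text \<open>\<open>m\<close> is a peak exactly when it has neighbours on both sides. The last letter
  of \<open>\<alpha>\<close> is no peak, being followed by a letter at least as large; the first
  letter of \<open>\<beta>\<close> is none, being preceded by a larger one.\<close>

lemma list_pk_append_max:
  assumes "\<forall>x\<in>set \<alpha>. x \<le> m" "\<forall>y\<in>set \<beta>. y < m"
  shows "list_pk (\<alpha> @ m # \<beta>) =
    list_pk \<alpha> + list_pk \<beta> + (if \<alpha> = [] \<or> \<beta> = [] then 0 else 1)"
  using assms
proof (induction \<alpha> rule: list_pk.induct)
  case (1 x y z zs)
  then show ?case by simp
next
  case "2_1"
  then show ?case by (simp add: list_pk_Cons_max)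
next
  case ("2_2" x)
  then show ?case using list_pk_Cons_max[of \<beta> m] by (cases \<beta>) auto
next
  case ("2_3" x y)
  then show ?case using list_pk_Cons_max[of \<beta> m] by (cases \<beta>) auto
qed

text \<open>The peak created at \<open>m\<close> when \<open>\<alpha>\<close> and \<open>\<beta>\<close> are nonempty accounts for the extra factor \<open>s\<close> in
  the product of their weights, so only the one-letter word needs a correction.\<close>

lemma weight_append_max:
  assumes "\<forall>x\<in>set \<alpha>. x \<le> m" "\<forall>y\<in>set \<beta>. y < m"
  shows "weight s (\<alpha> @ m # \<beta>) =
    weight s \<alpha> * weight s \<beta> - (if \<alpha> = [] \<and> \<beta> = [] then 1 - s else 0)"
  using list_pk_append_max[OF assms] by (auto simp: weight_def power_add)

text \<open>Cutting at the last \<open>k\<close> leaves an unrestricted prefix and a suffix over the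
  smaller alphabet.\<close>

lemma bij_betw_split_last_max:
  "bij_betw (\<lambda>(i, \<alpha>, \<beta>). \<alpha> @ k # \<beta>)
    (SIGMA i:{0..n}. words (Suc k) i \<times> words k (n - i))
    (words (Suc k) (Suc n) - words k (Suc n))" (is "bij_betw ?f ?S ?T")
proof (rule bij_betw_imageI)
  show "inj_on ?f ?S"
  proof (rule inj_onI)
    fix p q assume "p \<in> ?S" "q \<in> ?S" and eq: "?f p = ?f q"
    then obtain i \<alpha> \<beta> i' \<alpha>' \<beta>' where pq: "p = (i, \<alpha>, \<beta>)" "q = (i', \<alpha>', \<beta>')"
      and *: "\<alpha> \<in> words (Suc k) i" "\<beta> \<in> words k (n - i)"
        "\<alpha>' \<in> words (Suc k) i'" "\<beta>' \<in> words k (n - i')"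
      by (elim SigmaE) blast
    \<comment> \<open>Read backwards, \<open>\<beta>\<close> is the longest initial segment free of
      \<open>k\<close>, so the word determines it.\<close>
    have tw: "takeWhile (\<lambda>z. z \<noteq> k) (rev \<gamma> @ k # \<delta>) = rev \<gamma>" if "k \<notin> set \<gamma>" for \<gamma> \<delta>
      using that by (subst takeWhile_append2) auto
    have "k \<notin> set \<beta>" "k \<notin> set \<beta>'" using * by (auto simp: words_def)
    moreover have "rev \<beta> @ k # rev \<alpha> = rev \<beta>' @ k # rev \<alpha>'"
      using arg_cong[OF eq, of rev] by (simp add: pq)
    ultimately have "rev \<beta> = rev \<beta>'"
      using tw[of \<beta> "rev \<alpha>"] tw[of \<beta>' "rev \<alpha>'"] by simp
    then have "\<beta> = \<beta>'" by simp
    moreover from this have "\<alpha> = \<alpha>'" using eq by (simp add: pq)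
    ultimately have "\<alpha> = \<alpha>'" "\<beta> = \<beta>'" by simp_all
    then show "p = q" using * by (auto simp: pq words_def)
  qed
  show "?f ` ?S = ?T"
  proof (intro equalityI subsetI)
    fix w assume "w \<in> ?f ` ?S"
    then show "w \<in> ?T" by (auto simp: words_def subset_eq less_SucI)
  next
    fix w assume w: "w \<in> ?T"
    then have "k \<in> set w" by (auto simp: words_def less_Suc_eq)
    then obtain \<alpha> \<beta> where *: "w = \<alpha> @ k # \<beta>" "k \<notin> set \<beta>" by (auto dest: split_list_last)
    have "length \<alpha> + length \<beta> = n" "set \<alpha> \<subseteq> {..<Suc k}" "set \<beta> \<subseteq> {..<Suc k} - {k}"
      using w * by (auto simp: words_def)
    moreover from this have "set \<beta> \<subseteq> {..<k}" by auto
    ultimately have "(length \<alpha>, \<alpha>, \<beta>) \<in> ?S" by (auto simp: words_def)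
    then show "w \<in> ?f ` ?S" by (rule image_eqI[rotated]) (simp add: *)
  qed
qed

text \<open>The first term counts the words without \<open>k\<close>. The others split at their last
  \<open>k\<close>, marked by \<open>fps_X\<close>, and the subtracted term corrects the one-letter
  word. Solved for \<open>word_series s (Suc k)\<close>, this is a Moebius transform of
  \<open>word_series s k\<close>.\<close>

lemma word_series_Suc:
  "word_series s (Suc k) =
    word_series s k + fps_X * (word_series s (Suc k) * word_series s k) - fps_const (1 - s) * fps_X"
proof (rule fps_ext)
  fix n
  show "word_series s (Suc k) $ n =
    (word_series s k + fps_X * (word_series s (Suc k) * word_series s k) - fps_const (1 - s) * fps_X) $ n"
  proof (cases n)
    case 0
    then show ?thesis by simp
  next
    case (Suc m)
    let ?g = "\<lambda>i \<alpha> \<beta>. weight s \<alpha> * weight s \<beta> - (if \<alpha> = [] \<and> \<beta> = [] then 1 - s else 0)"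
    have sub: "words k (Suc m) \<subseteq> words (Suc k) (Suc m)" by (auto simp: words_def)
    have "(\<Sum>w\<in>words (Suc k) (Suc m) - words k (Suc m). weight s w) =
        (\<Sum>(i, \<alpha>, \<beta>)\<in>(SIGMA i:{0..m}. words (Suc k) i \<times> words k (m - i)). weight s (\<alpha> @ k # \<beta>))"
      by (subst sum.reindex_bij_betw[OF bij_betw_split_last_max, symmetric])
        (simp add: case_prod_unfold)
    also have "\<dots> = (\<Sum>(i, \<alpha>, \<beta>)\<in>(SIGMA i:{0..m}. words (Suc k) i \<times> words k (m - i)). ?g i \<alpha> \<beta>)"
      by (intro sum.cong refl) (auto simp: words_def subset_eq less_Suc_eq_le intro!: weight_append_max)
    also have "\<dots> = (\<Sum>i=0..m. \<Sum>\<alpha>\<in>words (Suc k) i. \<Sum>\<beta>\<in>words k (m - i). ?g i \<alpha> \<beta>)"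
      by (simp add: sum.cartesian_product sum.Sigma)
    also have "\<dots> = (\<Sum>i=0..m. word_series s (Suc k) $ i * word_series s k $ (m - i) -
        (if m = 0 then 1 - s else 0))"
    proof (intro sum.cong refl)
      fix i assume i: "i \<in> {0..m}"
      have "(\<Sum>\<alpha>\<in>words (Suc k) i. \<Sum>\<beta>\<in>words k (m - i). if \<alpha> = [] \<and> \<beta> = [] then 1 - s else 0) =
          (if m = 0 then 1 - s else 0)"
      proof (cases "m = 0")
        case True
        then show ?thesis using i by simp
      next
        case False
        then have "\<not> (\<alpha> = [] \<and> \<beta> = [])" if "\<alpha> \<in> words (Suc k) i" "\<beta> \<in> words k (m - i)" for \<alpha> \<beta>
          using that i by (auto simp: words_def)
        then have "(\<Sum>\<alpha>\<in>words (Suc k) i. \<Sum>\<beta>\<in>words k (m - i).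
            if \<alpha> = [] \<and> \<beta> = [] then 1 - s else 0) =
            (\<Sum>\<alpha>\<in>words (Suc k) i. \<Sum>\<beta>\<in>words k (m - i). 0)"
          by (intro sum.cong refl if_not_P)
        then show ?thesis using False by simp
      qed
      then show "(\<Sum>\<alpha>\<in>words (Suc k) i. \<Sum>\<beta>\<in>words k (m - i). ?g i \<alpha> \<beta>) =
        word_series s (Suc k) $ i * word_series s k $ (m - i) - (if m = 0 then 1 - s else 0)"
        by (simp add: sum_subtractf word_series_def sum_product)
    qed
    also have "\<dots> = (word_series s (Suc k) * word_series s k) $ m - (if m = 0 then 1 - s else 0)"
      by (simp add: sum_subtractf fps_mult_nth)
    finally have "(\<Sum>w\<in>words (Suc k) (Suc m). weight s w) = (\<Sum>w\<in>words k (Suc m). weight s w) +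
        ((word_series s (Suc k) * word_series s k) $ m - (if m = 0 then 1 - s else 0))"
      using sum.subset_diff[OF sub finite_words, of "weight s"] by (simp add: add.commute)
    then show ?thesis
      by (auto simp: Suc simp flip: word_series_nth)
  qed
qed

subsection \<open>Standardization\<close>

text \<open>Weakly increasing words that increase strictly at the positions in \<open>D\<close>, counted from 1.\<close>

definition stair_words :: "nat \<Rightarrow> nat \<Rightarrow> nat set \<Rightarrow> nat list set" where
  "stair_words k n D = {v \<in> words k n. \<forall>j. Suc j < n \<longrightarrow>
     v ! j \<le> v ! Suc j \<and> (Suc j \<in> D \<longrightarrow> v ! j < v ! Suc j)}"

lemma finite_stair_words [simp]: "finite (stair_words k n D)"
  unfolding stair_words_def by simp

lemma stair_words_le_last:
  assumes "v \<in> stair_words k n D" "i \<le> j" "j < n"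
  shows "v ! i \<le> v ! j"
  using assms(2,3)
proof (induction j rule: dec_induct)
  case (step j)
  then have "v ! j \<le> v ! Suc j" using assms(1) by (auto simp: stair_words_def)
  with step show ?case by simp
qed simp

text \<open>Words are separated by whether they end in \<open>k\<close>. Dropping a final
  \<open>k\<close> leaves a stair word over the same alphabet, or over the letters below
  \<open>k\<close> if \<open>D\<close> forces the last step to be strict.\<close>

lemma stair_words_Suc:
  "stair_words (Suc k) (Suc (Suc n)) D = stair_words k (Suc (Suc n)) D \<union>
    (\<lambda>v. v @ [k]) ` stair_words (if Suc n \<in> D then k else Suc k) (Suc n) D" (is "?L = ?A \<union> ?B")
proof (intro equalityI subsetI)
  fix v assume v: "v \<in> ?L"
  then have len: "length v = Suc (Suc n)" and vk: "\<And>i. i < Suc (Suc n) \<Longrightarrow> v ! i < Suc k"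
    by (auto simp: stair_words_def words_def subset_eq)
  show "v \<in> ?A \<union> ?B"
  proof (cases "v ! Suc n = k")
    case False
    then have "v ! i < k" if "i < Suc (Suc n)" for i
      using stair_words_le_last[OF v, of i "Suc n"] vk[of "Suc n"] that by auto
    then have "v \<in> ?A" using v len by (auto simp: stair_words_def words_def in_set_conv_nth)
    then show ?thesis ..
  next
    case True
    define u where "u = take (Suc n) v"
    have vu: "v = u @ [k]" using len True unfolding u_def
      by (metis lessI take_Suc_conv_app_nth take_all le_refl)
    have u: "length u = Suc n" "\<And>i. i < Suc n \<Longrightarrow> u ! i = v ! i" using len by (auto simp: u_def)
    have *: "u ! i < (if Suc n \<in> D then k else Suc k)" if "i < Suc n" for i
    proof -
      have "v ! i \<le> v ! n" using stair_words_le_last[OF v, of i n] that by simp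
      moreover have "Suc n \<in> D \<Longrightarrow> v ! n < k" using v True by (auto simp: stair_words_def)
      ultimately show ?thesis using u(2)[OF that] vk[of i] that by auto
    qed
    have "u \<in> stair_words (if Suc n \<in> D then k else Suc k) (Suc n) D"
      unfolding stair_words_def words_def mem_Collect_eq
    proof (intro conjI allI impI)
      show "set u \<subseteq> {..<if Suc n \<in> D then k else Suc k}"
        using * u(1) by (auto simp: in_set_conv_nth)
      show "length u = Suc n" by (rule u)
    next
      fix j assume "Suc j < Suc n"
      then show "u ! j \<le> u ! Suc j" using u(2)[of j] u(2)[of "Suc j"] v by (auto simp: stair_words_def)
    next
      fix j assume "Suc j < Suc n" "Suc j \<in> D"
      then show "u ! j < u ! Suc j" using u(2)[of j] u(2)[of "Suc j"] v by (auto simp: stair_words_def)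
    qed
    then show ?thesis using vu by auto
  qed
next
  fix v assume "v \<in> ?A \<union> ?B"
  then show "v \<in> ?L"
  proof
    assume "v \<in> ?A"
    then show ?thesis by (auto simp: stair_words_def words_def)
  next
    assume "v \<in> ?B"
    then obtain u where vu: "v = u @ [k]"
      and u: "u \<in> stair_words (if Suc n \<in> D then k else Suc k) (Suc n) D" by auto
    have len: "length u = Suc n" using u by (auto simp: stair_words_def words_def)
    have lt: "u ! n < (if Suc n \<in> D then k else Suc k)"
      using u len unfolding stair_words_def words_def
      by (metis (no_types, lifting) lessI lessThan_iff mem_Collect_eq nth_mem subset_eq)
    have "set v \<subseteq> {..<Suc k}" using u vu
      by (auto simp: stair_words_def words_def split: if_splits)
    moreover have "v ! j \<le> v ! Suc j \<and> (Suc j \<in> D \<longrightarrow> v ! j < v ! Suc j)"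
      if "Suc j < Suc (Suc n)" for j
    proof (cases "j = n")
      case True
      then show ?thesis using lt vu len by (auto simp: nth_append split: if_splits)
    next
      case False
      then show ?thesis using that u vu len by (auto simp: stair_words_def nth_append)
    qed
    ultimately show ?thesis using len vu by (auto simp: stair_words_def words_def)
  qed
qed

text \<open>The separation by the last letter becomes Pascal's rule, in an induction on
  \<open>k\<close> nested inside the induction on \<open>n\<close>.\<close>

lemma card_stair_words_Suc:
  "card (stair_words k (Suc n) D) = (k + n - card (D \<inter> {1..n})) choose Suc n"
proof (induction n arbitrary: k)
  case 0
  have "stair_words k 1 D = words k 1" by (auto simp: stair_words_def)
  then show ?case by (simp add: card_words)
next
  case (Suc n)
  define d where "d = card (D \<inter> {1..Suc n})"
  define e where "e = card (D \<inter> {1..n})"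
  have IH: "card (stair_words j (Suc n) D) = (j + n - e) choose Suc n" for j
    unfolding e_def by (rule Suc.IH)
  have d: "d = e + (if Suc n \<in> D then 1 else 0)"
  proof -
    have "D \<inter> {1..Suc n} = (D \<inter> {1..n}) \<union> (if Suc n \<in> D then {Suc n} else {})"
      by (auto simp: le_Suc_eq)
    then show ?thesis by (auto simp: d_def e_def card_insert_if)
  qed
  \<comment> \<open>With at most \<open>n\<close> forced ascents before the last step, the truncated
    subtractions below are exact.\<close>
  have "e \<le> card {1..n}" unfolding e_def by (rule card_mono) auto
  then have e: "e \<le> n" by simp
  have "card (stair_words k (Suc (Suc n)) D) = (k + Suc n - d) choose Suc (Suc n)"
  proof (induction k)
    case 0
    have "stair_words 0 (Suc (Suc n)) D = {}" by (auto simp: stair_words_def words_0_left)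
    then show ?case by (simp add: binomial_eq_0)
  next
    case (Suc k)
    let ?B = "(\<lambda>v. v @ [k]) ` stair_words (if Suc n \<in> D then k else Suc k) (Suc n) D"
    have "stair_words k (Suc (Suc n)) D \<inter> ?B = {}"
      by (auto simp: stair_words_def words_def)
    then have "card (stair_words (Suc k) (Suc (Suc n)) D) =
        card (stair_words k (Suc (Suc n)) D) + card ?B"
      unfolding stair_words_Suc by (intro card_Un_disjoint) auto
    also have "card ?B = card (stair_words (if Suc n \<in> D then k else Suc k) (Suc n) D)"
      by (rule card_image) (auto simp: inj_on_def)
    also have "\<dots> = (k + Suc n - d) choose Suc n"
      using d e by (auto simp: IH)
    also have "card (stair_words k (Suc (Suc n)) D) = (k + Suc n - d) choose Suc (Suc n)"
      by (rule Suc.IH)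
    also have "\<dots> + ((k + Suc n - d) choose Suc n) = Suc (k + Suc n - d) choose Suc (Suc n)"
      by simp
    also have "Suc (k + Suc n - d) = Suc k + Suc n - d" using d e by auto
    finally show ?case .
  qed
  then show ?case by (simp add: d_def)
qed

section \<open>Ranking the positions of a word\<close>

definition precedes :: "(nat \<Rightarrow> nat) \<Rightarrow> nat \<Rightarrow> nat \<Rightarrow> bool" where
  "precedes w i j \<longleftrightarrow> w i < w j \<or> w i = w j \<and> i < j"

text \<open>The rank of \<open>i\<close> counts the positions not behind it, \<open>i\<close>
  included, so ranks start at 1. Outside \<open>{1..n}\<close> it is the identity, as
  \<open>permutes\<close> demands.\<close>

definition standardization :: "nat \<Rightarrow> (nat \<Rightarrow> nat) \<Rightarrow> nat \<Rightarrow> nat" where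
  "standardization n w i =
     (if i \<in> {1..n} then card {j \<in> {1..n}. \<not> precedes w i j} else i)"

lemma standardization_mono:
  assumes "i \<in> {1..n}" "j \<in> {1..n}" "precedes w i j"
  shows "standardization n w i < standardization n w j"
proof -
  have "{l \<in> {1..n}. \<not> precedes w i l} \<subset> {l \<in> {1..n}. \<not> precedes w j l}"
    using assms by (auto simp: precedes_def)
  then have "card {l \<in> {1..n}. \<not> precedes w i l} < card {l \<in> {1..n}. \<not> precedes w j l}"
    by (rule psubset_card_mono[rotated]) simp
  then show ?thesis using assms by (simp add: standardization_def)
qed

lemma precedes_total: "i \<noteq> j \<Longrightarrow> precedes w i j \<or> precedes w j i"
  by (auto simp: precedes_def)

lemma standardization_less_iff:
  assumes "i \<in> {1..n}" "j \<in> {1..n}"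
  shows "standardization n w i < standardization n w j \<longleftrightarrow> precedes w i j"
  using standardization_mono[of i n j w] standardization_mono[of j n i w] precedes_total[of i j w] assms
  by force

lemma standardization_permutes: "standardization n w permutes {1..n}"
proof (rule bij_imp_permutes)
  have "inj_on (standardization n w) {1..n}"
    using standardization_mono[of _ n _ w] precedes_total[of _ _ w]
    by (metis inj_onI less_irrefl)
  moreover have "standardization n w ` {1..n} \<subseteq> {1..n}"
  proof clarify
    fix i assume i: "i \<in> {1..n}"
    have "i \<in> {j \<in> {1..n}. \<not> precedes w i j}" using i by (auto simp: precedes_def)
    then have "card {j \<in> {1..n}. \<not> precedes w i j} \<noteq> 0" by auto
    moreover have "card {j \<in> {1..n}. \<not> precedes w i j} \<le> card {1..n}"
      by (rule card_mono) auto
    moreover have "standardization n w i = card {j \<in> {1..n}. \<not> precedes w i j}"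
      using i by (simp only: standardization_def if_True)
    ultimately show "standardization n w i \<in> {1..n}"
      unfolding atLeastAtMost_iff card_atLeastAtMost by linarith
  qed
  ultimately show "bij_betw (standardization n w) {1..n} {1..n}"
    by (simp add: bij_betw_def endo_inj_surj)
qed (auto simp: standardization_def)

text \<open>A permutation whose order agrees with \<open>precedes\<close> maps the positions not
  behind \<open>i\<close> bijectively onto \<open>{1..\<pi> i}\<close>, so \<open>\<pi> i\<close> is
  the rank of \<open>i\<close>.\<close>

lemma standardization_unique:
  assumes \<pi>: "\<pi> permutes {1..n}"
    and mono: "\<And>i j. i \<in> {1..n} \<Longrightarrow> j \<in> {1..n} \<Longrightarrow> \<pi> i < \<pi> j \<Longrightarrow> precedes w i j"
  shows "standardization n w = \<pi>"
proof
  fix i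
  show "standardization n w i = \<pi> i"
  proof (cases "i \<in> {1..n}")
    case True
    have iff: "precedes w i j \<longleftrightarrow> \<pi> i < \<pi> j" if "j \<in> {1..n}" for j
    proof
      assume "precedes w i j"
      then have "\<not> precedes w j i" "i \<noteq> j" by (auto simp: precedes_def)
      then have "\<not> \<pi> j < \<pi> i" "\<pi> i \<noteq> \<pi> j"
        using mono[OF that True] permutes_inj[OF \<pi>] by (auto dest: injD)
      then show "\<pi> i < \<pi> j" by simp
    qed (use mono True that in auto)
    have "\<pi> i \<le> n" using permutes_in_image[OF \<pi>, of i] True by auto
    have "\<pi> ` {j \<in> {1..n}. \<not> precedes w i j} = {1..\<pi> i}"
    proof (intro equalityI subsetI)
      fix p assume "p \<in> {1..\<pi> i}"
      then have "p \<in> {1..n}" using \<open>\<pi> i \<le> n\<close> by auto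
      then obtain j where "j \<in> {1..n}" "p = \<pi> j" using permutes_image[OF \<pi>] by blast
      then show "p \<in> \<pi> ` {j \<in> {1..n}. \<not> precedes w i j}"
        using iff \<open>p \<in> {1..\<pi> i}\<close> by auto
    next
      fix p assume "p \<in> \<pi> ` {j \<in> {1..n}. \<not> precedes w i j}"
      then obtain j where j: "j \<in> {1..n}" "\<not> precedes w i j" "p = \<pi> j" by auto
      then have "\<pi> j \<in> {1..n}" using permutes_in_image[OF \<pi>, of j] by simp
      then show "p \<in> {1..\<pi> i}" using j iff by auto
    qed
    moreover have "card (\<pi> ` {j \<in> {1..n}. \<not> precedes w i j}) = card {j \<in> {1..n}. \<not> precedes w i j}"
      using permutes_inj[OF \<pi>] by (intro card_image) (auto simp: inj_on_def)
    ultimately show ?thesis using True by (simp add: standardization_def)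
  next
    case False
    then show ?thesis using permutes_not_in[OF \<pi> False] by (simp only: standardization_def if_False)
  qed
qed

section \<open>Words as pairs of a permutation and a sorted word\<close>

definition des_set :: "nat \<Rightarrow> (nat \<Rightarrow> nat) \<Rightarrow> nat set" where
  "des_set n \<pi> = {i. 1 \<le> i \<and> i < n \<and> \<pi> i > \<pi> (i + 1)}"

text \<open>Values of \<open>\<pi>\<close> start at 1 and list indices at 0, hence the
  shift.\<close>

definition permute_word :: "nat \<Rightarrow> (nat \<Rightarrow> nat) \<Rightarrow> nat list \<Rightarrow> nat list" where
  "permute_word n \<pi> v = map (\<lambda>i. v ! (\<pi> i - 1)) [1..<Suc n]"

lemma length_permute_word [simp]: "length (permute_word n \<pi> v) = n"
  by (simp add: permute_word_def del: upt_Suc)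

text \<open>By transitivity it suffices to compare consecutive values \<open>q\<close> and
  \<open>Suc q\<close> of \<open>\<pi>\<close>. A tie in \<open>v\<close> there excludes a descent
  of \<open>inv \<pi>\<close>, so equal letters are placed from left to right.\<close>

lemma permute_word_precedes:
  assumes \<pi>: "\<pi> permutes {1..n}" and v: "v \<in> stair_words k n (des_set n (inv \<pi>))"
    and ij: "i \<in> {1..n}" "j \<in> {1..n}" "\<pi> i < \<pi> j"
  shows "precedes (\<lambda>i. v ! (\<pi> i - 1)) i j"
proof -
  let ?R = "\<lambda>p q. v ! (p - 1) < v ! (q - 1) \<or> v ! (p - 1) = v ! (q - 1) \<and> inv \<pi> p < inv \<pi> q"
  have adj: "?R q (Suc q)" if "1 \<le> q" "Suc q \<le> n" for q
  proof -
    have "v ! (q - 1) \<le> v ! q" "inv \<pi> q > inv \<pi> (Suc q) \<Longrightarrow> v ! (q - 1) < v ! q"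
      using v that unfolding stair_words_def des_set_def
      by (auto dest!: spec[where x = "q - 1"])
    moreover have "inv \<pi> q \<noteq> inv \<pi> (Suc q)"
      using inj_eq[OF permutes_inj[OF permutes_inv[OF \<pi>]]] by simp
    ultimately show ?thesis by (auto simp: neq_iff)
  qed
  have "?R p q" if "1 \<le> p" "Suc p \<le> q" "q \<le> n" for p q
    using that(2,3)
  proof (induction q rule: dec_induct)
    case base
    then show ?case using adj[of p] that by simp
  next
    case (step q)
    then have "?R p q" "?R q (Suc q)" using \<open>1 \<le> p\<close> adj[of q] by simp_all
    then show ?case by linarith
  qed
  from this[of "\<pi> i" "\<pi> j"] show ?thesis
    using ij permutes_in_image[OF \<pi>, of i] permutes_in_image[OF \<pi>, of j]
    by (simp add: precedes_def permutes_inverses[OF \<pi>] Suc_le_eq)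
qed

lemma standardization_permute_word:
  assumes "\<pi> permutes {1..n}" "v \<in> stair_words k n (des_set n (inv \<pi>))"
  shows "standardization n (\<lambda>i. v ! (\<pi> i - 1)) = \<pi>"
  using assms permute_word_precedes by (intro standardization_unique) auto

lemma nth_permute_word: "i \<in> {1..n} \<Longrightarrow> permute_word n \<pi> v ! (i - 1) = v ! (\<pi> i - 1)"
  by (auto simp: permute_word_def simp del: upt_Suc)

lemma standardization_cong:
  assumes "\<And>i. i \<in> {1..n} \<Longrightarrow> w i = w' i"
  shows "standardization n w = standardization n w'"
proof
  fix i
  have "{j \<in> {1..n}. \<not> precedes w i j} = {j \<in> {1..n}. \<not> precedes w' i j}" if "i \<in> {1..n}"
    using assms that by (auto simp: precedes_def)
  then show "standardization n w i = standardization n w' i" by (simp add: standardization_def)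
qed

text \<open>The inverse sends a word to its standardization together with its sorted
  rearrangement.\<close>

lemma bij_betw_permute_word:
  "bij_betw (\<lambda>(\<pi>, v). permute_word n \<pi> v)
    (SIGMA \<pi>:sym_group n. stair_words k n (des_set n (inv \<pi>))) (words k n)"
    (is "bij_betw ?f ?S _")
proof (rule bij_betw_imageI)
  show "inj_on ?f ?S"
  proof (rule inj_onI)
    fix p q assume "p \<in> ?S" "q \<in> ?S" and f_eq: "?f p = ?f q"
    then obtain \<pi> v \<pi>' v' where pq: "p = (\<pi>, v)" "q = (\<pi>', v')"
      and \<pi>: "\<pi> permutes {1..n}" "\<pi>' permutes {1..n}"
      and v: "v \<in> stair_words k n (des_set n (inv \<pi>))" "v' \<in> stair_words k n (des_set n (inv \<pi>'))"
      unfolding sym_group_def by (elim SigmaE) blast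
    have eq: "v ! (\<pi> i - 1) = v' ! (\<pi>' i - 1)" if "i \<in> {1..n}" for i
      using nth_permute_word[OF that, of \<pi> v] nth_permute_word[OF that, of \<pi>' v'] f_eq
      by (simp add: pq)
    have \<pi>_eq: "\<pi> = \<pi>'"
      using standardization_permute_word[OF \<pi>(1) v(1)] standardization_permute_word[OF \<pi>(2) v(2)]
        standardization_cong[of n "\<lambda>i. v ! (\<pi> i - 1)" "\<lambda>i. v' ! (\<pi>' i - 1)"] eq by metis
    have len: "length v = n" "length v' = n" using v by (auto simp: stair_words_def words_def)
    have "v = v'"
    proof (rule nth_equalityI)
      fix m assume "m < length v"
      then have "Suc m \<in> {1..n}" using len by auto
      then obtain i where i: "i \<in> {1..n}" "Suc m = \<pi> i" using permutes_image[OF \<pi>(1)] by blast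
      show "v ! m = v' ! m" using eq[OF i(1)] \<pi>_eq i(2)[symmetric] by simp
    qed (simp add: len)
    then show "p = q" using \<pi>_eq pq by simp
  qed
  show "?f ` ?S = words k n"
  proof (intro equalityI subsetI)
    fix w assume "w \<in> ?f ` ?S"
    then obtain \<pi> v where w: "w = permute_word n \<pi> v" and \<pi>: "\<pi> permutes {1..n}"
      and v: "v \<in> stair_words k n (des_set n (inv \<pi>))"
      by (auto simp: sym_group_def)
    have "v ! (\<pi> i - 1) \<in> set v" if "i \<in> {1..n}" for i
      using permutes_in_image[OF \<pi>, of i] that v
      by (intro nth_mem) (auto simp: stair_words_def words_def)
    then have "set w \<subseteq> set v" by (auto simp: w permute_word_def simp del: upt_Suc)
    moreover have "length w = n" by (simp add: w)
    ultimately show "w \<in> words k n" using v by (auto simp: stair_words_def words_def)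
  next
    fix w assume w: "w \<in> words k n"
    define f where "f i = w ! (i - 1)" for i
    define \<pi> where "\<pi> = standardization n f"
    have \<pi>: "\<pi> permutes {1..n}" unfolding \<pi>_def by (rule standardization_permutes)
    have \<pi>': "inv \<pi> permutes {1..n}" using \<pi> by (rule permutes_inv)
    \<comment> \<open>\<open>inv \<pi> p\<close> is the position of rank \<open>p\<close>, so this
      lists the letters of \<open>w\<close> in sorted order.\<close>
    define v where "v = map (\<lambda>p. f (inv \<pi> p)) [1..<Suc n]"
    have len: "length w = n" "length v = n" using w by (simp_all add: words_def v_def)
    have nth_v: "v ! m = f (inv \<pi> (Suc m))" if "m < n" for m
      using that by (simp add: v_def del: upt_Suc)
    have f: "f i \<in> set w" if "i \<in> {1..n}" for i
      unfolding f_def using that len by (intro nth_mem) auto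
    have prec: "precedes f (inv \<pi> (Suc m)) (inv \<pi> (Suc (Suc m)))" if "Suc m < n" for m
    proof -
      have "inv \<pi> (Suc m) \<in> {1..n}" "inv \<pi> (Suc (Suc m)) \<in> {1..n}"
        using permutes_in_image[OF \<pi>', of "Suc m"] permutes_in_image[OF \<pi>', of "Suc (Suc m)"] that
        by auto
      from standardization_less_iff[OF this, of f] show ?thesis
        by (simp add: \<pi>_def[symmetric] permutes_inverses[OF \<pi>])
    qed
    have "v \<in> stair_words k n (des_set n (inv \<pi>))"
      unfolding stair_words_def words_def mem_Collect_eq
    proof (intro conjI allI impI)
      have "f (inv \<pi> p) \<in> set w" if "p \<in> {1..n}" for p
        using permutes_in_image[OF \<pi>', of p] that by (intro f) simp
      then have "set v \<subseteq> set w" by (auto simp: v_def simp del: upt_Suc)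
      then show "set v \<subseteq> {..<k}" using w by (auto simp: words_def)
      show "length v = n" by (rule len)
    next
      fix j assume "Suc j < n"
      then show "v ! j \<le> v ! Suc j" using prec[of j] by (auto simp: nth_v precedes_def)
    next
      fix j assume "Suc j < n" "Suc j \<in> des_set n (inv \<pi>)"
      then show "v ! j < v ! Suc j" using prec[of j] by (auto simp: nth_v precedes_def des_set_def)
    qed
    moreover have "permute_word n \<pi> v = w"
    proof (rule nth_equalityI)
      fix m assume "m < length (permute_word n \<pi> v)"
      then have m: "m < n" by simp
      have "\<pi> (Suc m) \<in> {1..n}" using permutes_in_image[OF \<pi>, of "Suc m"] m by simp
      then have "v ! (\<pi> (Suc m) - 1) = f (inv \<pi> (\<pi> (Suc m)))"
        by (subst nth_v) auto
      also have "\<dots> = w ! m" by (simp add: permutes_inverses[OF \<pi>] f_def)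
      finally show "permute_word n \<pi> v ! m = w ! m"
        using m by (simp add: permute_word_def del: upt_Suc)
    qed (simp add: len)
    ultimately show "w \<in> ?f ` ?S"
      using \<pi> by (intro image_eqI[where x = "(\<pi>, v)"]) (auto simp: sym_group_def)
  qed
qed

lemma list_pk_eq_card:
  "list_pk w = card {j. j + 2 < length w \<and> w ! j \<le> w ! (j + 1) \<and> w ! (j + 2) < w ! (j + 1)}"
proof (induction w rule: list_pk.induct)
  case (1 x y z zs)
  let ?S = "\<lambda>w. {j. j + 2 < length w \<and> w ! j \<le> w ! (j + 1) \<and> w ! (j + 2) < w ! (j + 1)}"
  have "?S (x # y # z # zs) = (if x \<le> y \<and> z < y then {0} else {}) \<union> Suc ` ?S (y # z # zs)"
  proof (rule set_eqI)
    fix j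
    show "j \<in> ?S (x # y # z # zs) \<longleftrightarrow>
      j \<in> (if x \<le> y \<and> z < y then {0} else {}) \<union> Suc ` ?S (y # z # zs)"
      by (cases j) (auto simp: image_iff)
  qed
  moreover have "finite (?S (y # z # zs))"
    by (rule finite_subset[of _ "{..<length (y # z # zs)}"]) auto
  ultimately have "card (?S (x # y # z # zs)) =
      (if x \<le> y \<and> z < y then 1 else 0) + card (?S (y # z # zs))"
    by (subst (asm) refl) (simp add: card_Un_disjoint card_image)
  then show ?case using 1 by simp
qed auto

text \<open>Between neighbouring positions, an ascent of \<open>\<pi>\<close> is a weak ascent of
  the word and a descent of \<open>\<pi>\<close> is a strict one.\<close>

lemma list_pk_permute_word:
  assumes \<pi>: "\<pi> permutes {1..n}" and v: "v \<in> stair_words k n (des_set n (inv \<pi>))"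
  shows "list_pk (permute_word n \<pi> v) = pk n \<pi>"
proof -
  let ?f = "\<lambda>i. v ! (\<pi> i - 1)"
  have less: "\<pi> i < \<pi> j \<longleftrightarrow> precedes ?f i j" if "i \<in> {1..n}" "j \<in> {1..n}" for i j
    using standardization_less_iff[OF that, of ?f] standardization_permute_word[OF assms] by simp
  have nth: "permute_word n \<pi> v ! j = ?f (Suc j)" if "j < n" for j
    using that by (simp add: permute_word_def del: upt_Suc)
  \<comment> \<open>\<open>j\<close> is the left neighbour counted from 0, so the peak sits at
    \<open>j + 2\<close> counted from 1.\<close>
  have "{i. 2 \<le> i \<and> i < n \<and> \<pi> (i - 1) < \<pi> i \<and> \<pi> i > \<pi> (i + 1)} =
    (\<lambda>j. j + 2) ` {j. j + 2 < length (permute_word n \<pi> v) \<and>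
       permute_word n \<pi> v ! j \<le> permute_word n \<pi> v ! (j + 1) \<and>
       permute_word n \<pi> v ! (j + 2) < permute_word n \<pi> v ! (j + 1)}" (is "?P = ?g ` ?Q")
  proof -
    have "j + 2 \<in> ?P \<longleftrightarrow> j \<in> ?Q" for j
    proof (cases "j + 2 < n")
      case True
      then show ?thesis
        using less[of "j + 1" "j + 2"] less[of "j + 3" "j + 2"]
        by (auto simp: nth precedes_def numeral_eq_Suc)
    next
      case False
      then show ?thesis by simp
    qed
    moreover have "i \<in> ?P \<Longrightarrow> i = (i - 2) + 2" for i by auto
    ultimately show ?thesis
      by (intro equalityI subsetI) (metis (no_types, lifting) image_iff)+
  qed
  then have "pk n \<pi> = card (?g ` ?Q)" by (simp add: pk_def)
  also have "\<dots> = card ?Q" by (rule card_image) (auto simp: inj_on_def)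
  finally show ?thesis by (simp add: list_pk_eq_card)
qed

text \<open>The words with standardization \<open>\<pi>\<close> all have \<open>pk n \<pi>\<close>
  peaks, and there are as many as stair words for the descents of \<open>inv \<pi>\<close>.\<close>

lemma word_series_nth_eq_sum_perms:
  assumes "n \<ge> 1"
  shows "word_series s k $ n =
    (\<Sum>\<pi>\<in>sym_group n. s ^ (pk n \<pi> + 1) * of_nat ((k + n - 1 - ides n \<pi>) choose n))"
proof -
  obtain m where n: "n = Suc m" using assms by (cases n) auto
  have fin: "finite (sym_group n)" unfolding sym_group_def by (rule finite_permutations) simp
  have "word_series s k $ n =
      (\<Sum>(\<pi>, v)\<in>(SIGMA \<pi>:sym_group n. stair_words k n (des_set n (inv \<pi>))).
        weight s (permute_word n \<pi> v))"
    unfolding word_series_nth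
    by (subst sum.reindex_bij_betw[OF bij_betw_permute_word, symmetric]) (simp add: case_prod_unfold)
  also have "\<dots> = (\<Sum>\<pi>\<in>sym_group n. \<Sum>v\<in>stair_words k n (des_set n (inv \<pi>)).
        weight s (permute_word n \<pi> v))"
    using fin by (subst sum.Sigma) auto
  also have "\<dots> = (\<Sum>\<pi>\<in>sym_group n. \<Sum>v\<in>stair_words k n (des_set n (inv \<pi>)). s ^ (pk n \<pi> + 1))"
  proof (intro sum.cong refl)
    fix \<pi> v assume "\<pi> \<in> sym_group n" "v \<in> stair_words k n (des_set n (inv \<pi>))"
    then have "list_pk (permute_word n \<pi> v) = pk n \<pi>"
      by (intro list_pk_permute_word) (auto simp: sym_group_def)
    moreover have "permute_word n \<pi> v \<noteq> []" using n length_permute_word[of n \<pi> v] by force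
    ultimately show "weight s (permute_word n \<pi> v) = s ^ (pk n \<pi> + 1)"
      by (simp add: weight_def)
  qed
  also have "\<dots> = (\<Sum>\<pi>\<in>sym_group n. s ^ (pk n \<pi> + 1) * of_nat ((k + n - 1 - ides n \<pi>) choose n))"
  proof (intro sum.cong refl)
    fix \<pi> assume "\<pi> \<in> sym_group n"
    have "des_set n (inv \<pi>) \<inter> {1..m} = des_set n (inv \<pi>)" by (auto simp: des_set_def n)
    then have "card (stair_words k n (des_set n (inv \<pi>))) = (k + n - 1 - ides n \<pi>) choose n"
      using card_stair_words_Suc[of k m "des_set n (inv \<pi>)"]
      by (simp add: n ides_def des_def des_set_def)
    then show "(\<Sum>v\<in>stair_words k n (des_set n (inv \<pi>)). s ^ (pk n \<pi> + 1)) =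
        s ^ (pk n \<pi> + 1) * of_nat ((k + n - 1 - ides n \<pi>) choose n)"
      by (simp add: mult.commute)
  qed
  finally show ?thesis .
qed

subsection \<open>The Riccati equation\<close>

text \<open>With \<open>V * W = U - c * ?X\<close>, multiplication by \<open>W\<^sup>2\<close> turns
  both \<open>fps_deriv V\<close> and \<open>V\<^sup>2 - c\<close> into multiples of
  \<open>U\<^sup>2 - c\<close>. This carries the equation from \<open>k\<close> to
  \<open>Suc k\<close>, once \<open>W\<^sup>2\<close> is cancelled.\<close>

lemma word_series_ODE:
  fixes s :: "'a::field_char_0"
  shows "(1 - fps_const (1 - s) * fps_X\<^sup>2) * fps_deriv (word_series s k) =
    of_nat k * ((word_series s k)\<^sup>2 - fps_const (1 - s))"
proof (induction k)
  case 0
  then show ?case by (simp add: word_series_0)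
next
  case (Suc k)
  let ?X = "fps_X :: 'a fps"
  define U V c where "U = word_series s k" and "V = word_series s (Suc k)"
    and "c = (fps_const (1 - s) :: 'a fps)"
  define W where "W = 1 - ?X * U"
  have W: "W \<noteq> 0"
  proof
    assume "W = 0"
    then have "W $ 0 = 0" by simp
    then show False by (simp add: W_def)
  qed
  have VW: "V * W = U - c * ?X"
    using word_series_Suc[of s k] by (simp add: W_def U_def V_def c_def algebra_simps)
  have IH: "(1 - c * ?X\<^sup>2) * fps_deriv U = of_nat k * (U\<^sup>2 - c)"
    using Suc unfolding U_def c_def .
  have c': "fps_deriv c = 0" by (simp add: c_def)
  have "fps_deriv (V * W) = fps_deriv (U - c * ?X)" by (simp add: VW)
  then have V'W: "fps_deriv V * W = fps_deriv U - c + V * (U + ?X * fps_deriv U)"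
    by (simp add: W_def c' algebra_simps)
  have "fps_deriv V * W\<^sup>2 = (fps_deriv U - c) * W + (V * W) * (U + ?X * fps_deriv U)"
    unfolding power2_eq_square mult.assoc[symmetric] V'W by (simp add: algebra_simps)
  also have "\<dots> = (1 - c * ?X\<^sup>2) * fps_deriv U + (U\<^sup>2 - c)"
    unfolding VW unfolding W_def by (simp add: algebra_simps power2_eq_square)
  also have "\<dots> = of_nat (Suc k) * (U\<^sup>2 - c)"
    unfolding IH by (simp add: algebra_simps)
  finally have 1: "fps_deriv V * W\<^sup>2 = of_nat (Suc k) * (U\<^sup>2 - c)" .
  have "(V\<^sup>2 - c) * W\<^sup>2 = (V * W)\<^sup>2 - c * W\<^sup>2" by (simp add: algebra_simps power2_eq_square)
  also have "\<dots> = (U\<^sup>2 - c) * (1 - c * ?X\<^sup>2)"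
    unfolding VW unfolding W_def by (simp add: algebra_simps power2_eq_square)
  finally have 2: "(V\<^sup>2 - c) * W\<^sup>2 = (U\<^sup>2 - c) * (1 - c * ?X\<^sup>2)" .
  have "((1 - c * ?X\<^sup>2) * fps_deriv V) * W\<^sup>2 = (of_nat (Suc k) * (V\<^sup>2 - c)) * W\<^sup>2"
    unfolding mult.assoc 1 2 by (simp add: mult.commute mult.left_commute)
  then show ?case using W unfolding V_def c_def by simp
qed

text \<open>At \<open>n = 0\<close> and \<open>n = 1\<close> the factor
  \<open>of_nat (n - 1)\<close> is 0, matching the vanishing low coefficients of
  \<open>fps_X\<^sup>2 * fps_deriv A\<close>.\<close>

lemma one_minus_X_power2_times_deriv_nth:
  fixes A :: "'a::field_char_0 fps"
  shows "((1 - fps_const c * fps_X\<^sup>2) * fps_deriv A) $ n =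
    of_nat (Suc n) * A $ Suc n - c * of_nat (n - 1) * A $ (n - 1)"
proof -
  have "(1 - fps_const c * fps_X\<^sup>2) * fps_deriv A =
      fps_deriv A - fps_const c * (fps_X\<^sup>2 * fps_deriv A)"
    by (simp add: algebra_simps)
  moreover have "(fps_X\<^sup>2 * fps_deriv A) $ n = of_nat (n - 1) * A $ (n - 1)"
  proof (cases "n < 2")
    case True
    then show ?thesis by (auto simp: fps_X_power_mult_nth less_2_cases_iff)
  next
    case False
    then have "n - 2 + 1 = n - 1" by simp
    with False show ?thesis by (simp only: fps_X_power_mult_nth if_False fps_deriv_nth)
  qed
  ultimately show ?thesis by simp
qed

text \<open>Coefficient \<open>m\<close> of the equation determines \<open>A $ Suc m\<close> from
  earlier coefficients, as \<open>Suc m\<close> is invertible in characteristic 0.\<close>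

lemma riccati_unique:
  fixes A B :: "'a::field_char_0 fps"
  assumes A: "(1 - fps_const c * fps_X\<^sup>2) * fps_deriv A = of_nat k * (A\<^sup>2 - fps_const c)"
    and B: "(1 - fps_const c * fps_X\<^sup>2) * fps_deriv B = of_nat k * (B\<^sup>2 - fps_const c)"
    and AB: "A $ 0 = B $ 0"
  shows "A = B"
proof (rule fps_ext)
  fix n
  show "A $ n = B $ n"
  proof (induction n rule: less_induct)
    case (less n)
    show ?case
    proof (cases n)
      case 0
      then show ?thesis using AB by simp
    next
      case (Suc m)
      have k: "(of_nat k :: 'a fps) = fps_const (of_nat k)" by (simp add: fps_of_nat)
      have "(of_nat k * (A\<^sup>2 - fps_const c)) $ m = (of_nat k * (B\<^sup>2 - fps_const c)) $ m"
        using less Suc by (simp add: k power2_eq_square fps_mult_nth)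
      then have "of_nat (Suc m) * A $ Suc m - c * of_nat (m - 1) * A $ (m - 1) =
          of_nat (Suc m) * B $ Suc m - c * of_nat (m - 1) * B $ (m - 1)"
        unfolding one_minus_X_power2_times_deriv_nth[symmetric] A B .
      moreover have "A $ (m - 1) = B $ (m - 1)" using less[of "m - 1"] Suc by simp
      ultimately have "of_nat (Suc m) * A $ Suc m = of_nat (Suc m) * B $ Suc m" by simp
      then show ?thesis using Suc by (simp del: of_nat_Suc)
    qed
  qed
qed

text \<open>The value of \<open>word_series s k $ n\<close> as a polynomial in \<open>k\<close>.\<close>

definition word_poly :: "'a::field_char_0 \<Rightarrow> nat \<Rightarrow> 'a poly" where
  "word_poly s n = (if n = 0 then 1 else \<Sum>\<pi>\<in>sym_group n.
     smult (s ^ (pk n \<pi> + 1) / fact n) (\<Prod>i<n. [:of_nat (n - 1 - ides n \<pi>) - of_nat i, 1:]))"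

lemma des_less: "n \<ge> 1 \<Longrightarrow> des n \<pi> < n"
proof -
  assume n: "n \<ge> 1"
  have "des n \<pi> \<le> card {1..<n}" unfolding des_def by (rule card_mono) auto
  then show ?thesis using n by simp
qed

lemma ides_less: "n \<ge> 1 \<Longrightarrow> ides n \<pi> < n"
  unfolding ides_def by (rule des_less)

lemma poly_word_poly:
  fixes s :: "'a::field_char_0"
  shows "poly (word_poly s n) (of_nat k) = word_series s k $ n"
proof (cases "n = 0")
  case False
  have prod: "(\<Prod>i<n. of_nat k + (of_nat (n - 1 - d) - of_nat i) :: 'a) =
      fact n * of_nat ((k + n - 1 - d) choose n)" if "d < n" for d
  proof -
    \<comment> \<open>\<open>d < n\<close> makes the truncated subtraction exact, so the factors
      form the falling factorial of \<open>k + n - 1 - d\<close>.\<close>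
    have "(of_nat k + (of_nat (n - 1 - d) - of_nat i) :: 'a) = of_nat (k + n - 1 - d) - of_nat i" for i
      using that by (simp add: add_diff_eq flip: of_nat_add)
    then have "(\<Prod>i<n. of_nat k + (of_nat (n - 1 - d) - of_nat i) :: 'a) =
        (\<Prod>i<n. of_nat (k + n - 1 - d) - of_nat i)" by (simp only:)
    then show ?thesis
      by (simp add: binomial_gbinomial gbinomial_prod_rev lessThan_atLeast0)
  qed
  have n: "n \<ge> 1" using False by simp
  have "poly (word_poly s n) (of_nat k) = (\<Sum>\<pi>\<in>sym_group n. s ^ (pk n \<pi> + 1) / fact n *
      (\<Prod>i<n. of_nat k + (of_nat (n - 1 - ides n \<pi>) - of_nat i)))"
    using False by (simp add: word_poly_def poly_sum poly_prod add.commute)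
  also have "\<dots> = word_series s k $ n"
    unfolding word_series_nth_eq_sum_perms[OF n] prod[OF ides_less[OF n]] by (simp add: mult.assoc)
  finally show ?thesis .
qed (simp add: word_poly_def)

lemma prod_monic_linear:
  fixes f :: "nat \<Rightarrow> 'a::field_char_0"
  shows "degree (\<Prod>i<n. [:f i, 1:]) = n" "coeff (\<Prod>i<n. [:f i, 1:]) n = 1"
proof -
  show deg: "degree (\<Prod>i<n. [:f i, 1:]) = n"
    by (subst degree_prod_sum_eq) auto
  show "coeff (\<Prod>i<n. [:f i, 1:]) n = 1"
    using lead_coeff_prod[of "\<lambda>i. [:f i, 1:]" "{..<n}"] by (simp add: deg)
qed

lemma degree_word_poly: "degree (word_poly s n) \<le> n"
  unfolding word_poly_def
  by (auto intro!: degree_sum_le order_trans[OF degree_smult_le] simp: prod_monic_linear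
      sym_group_def finite_permutations)

text \<open>Each binomial coefficient, as a polynomial in \<open>k\<close>, has leading coefficient
  \<open>1 / fact n\<close>, so only the peak weights are left to sum.\<close>

lemma coeff_word_poly: "coeff (word_poly s n) n = peak_poly n s / fact n"
  by (simp add: word_poly_def peak_poly_def coeff_sum prod_monic_linear sum_divide_distrib)

lemma coeff_mult_degree_le:
  fixes p q :: "'a::comm_ring_1 poly"
  assumes "degree p \<le> i" "degree q \<le> j"
  shows "coeff (p * q) (i + j) = coeff p i * coeff q j"
proof -
  have "coeff p l * coeff q (i + j - l) = (if l = i then coeff p i * coeff q j else 0)" for l
    using assms by (cases l i rule: linorder_cases) (auto simp: coeff_eq_0)
  then show ?thesis by (simp add: coeff_mult)
qed

lemma poly_eq_if_of_nat:
  fixes p q :: "'a::field_char_0 poly"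
  assumes "\<And>k. poly p (of_nat k) = poly q (of_nat k)"
  shows "p = q"
proof (rule ccontr)
  assume "p \<noteq> q"
  then have "finite {x. poly (p - q) x = 0}" by (intro poly_roots_finite) simp
  moreover have "range (of_nat :: nat \<Rightarrow> 'a) \<subseteq> {x. poly (p - q) x = 0}" using assms by auto
  ultimately have "finite (range (of_nat :: nat \<Rightarrow> 'a))" by (rule finite_subset[rotated])
  then show False using finite_imageD[of "of_nat :: nat \<Rightarrow> 'a" UNIV] inj_of_nat by auto
qed

section \<open>Exponential generating function of the peak polynomials\<close>

definition peak_series :: "'a::field_char_0 \<Rightarrow> 'a fps" where
  "peak_series s = Abs_fps (\<lambda>n. peak_poly n s / fact n)"

text \<open>Coefficient \<open>n\<close> of the equation for \<open>word_series s k\<close> holds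
  for all \<open>k\<close>, hence as an identity of polynomials in \<open>k\<close>. Comparing the
  coefficients of \<open>k ^ Suc n\<close> gives the claim.\<close>

lemma peak_series_riccati: "fps_deriv (peak_series s) = (peak_series s)\<^sup>2 - fps_const (1 - s)"
proof (rule fps_ext)
  fix n
  let ?q = "word_poly s" and ?c = "1 - s"
  let ?L = "smult (of_nat (Suc n)) (?q (Suc n)) - smult (?c * of_nat (n - 1)) (?q (n - 1))"
  let ?R = "(\<Sum>i=0..n. ?q i * ?q (n - i)) - (if n = 0 then [:?c:] else 0)"
  \<comment> \<open>\<open>pCons 0\<close> is the factor \<open>k\<close> on the right-hand side of
    the equation.\<close>
  have "?L = pCons 0 ?R"
  proof (rule poly_eq_if_of_nat)
    fix k
    have k: "(of_nat k :: 'a fps) = fps_const (of_nat k)" by (simp add: fps_of_nat)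
    have "poly ?L (of_nat k) =
        ((1 - fps_const ?c * fps_X\<^sup>2) * fps_deriv (word_series s k)) $ n"
      unfolding one_minus_X_power2_times_deriv_nth by (simp add: poly_word_poly)
    also have "\<dots> = poly (pCons 0 ?R) (of_nat k)"
      unfolding word_series_ODE k fps_mult_left_const_nth
      by (simp add: power2_eq_square fps_mult_nth poly_sum poly_word_poly)
    finally show "poly ?L (of_nat k) = poly (pCons 0 ?R) (of_nat k)" .
  qed
  then have "coeff ?L (Suc n) = coeff ?R n" by simp
  \<comment> \<open>The contribution of \<open>fps_X\<^sup>2\<close> has too small a degree in
    \<open>k\<close> to reach the leading coefficient.\<close>
  moreover have "coeff (?q (n - 1)) (Suc n) = 0"
    using degree_word_poly[of s "n - 1"] by (intro coeff_eq_0) linarith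
  moreover have "coeff (?q i * ?q (n - i)) n = coeff (?q i) i * coeff (?q (n - i)) (n - i)"
    if "i \<le> n" for i
    using coeff_mult_degree_le[OF degree_word_poly[of s i] degree_word_poly[of s "n - i"]] that by simp
  ultimately show "fps_deriv (peak_series s) $ n = ((peak_series s)\<^sup>2 - fps_const ?c) $ n"
    by (simp add: coeff_sum peak_series_def power2_eq_square fps_mult_nth coeff_word_poly del: of_nat_Suc)
qed

text \<open>This is \<open>artanh (r z) / r\<close>, in a form that also makes sense for \<open>r = 0\<close>.\<close>

definition odd_cycle_series :: "'a::field_char_0 \<Rightarrow> 'a fps" where
  "odd_cycle_series r = fps_integral0 (inverse (1 - fps_const (r\<^sup>2) * fps_X\<^sup>2))"

lemma odd_cycle_series_ODE:
  "(1 - fps_const (r\<^sup>2) * fps_X\<^sup>2) * fps_deriv (odd_cycle_series r) = 1"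
proof -
  have "(1 - fps_const (r\<^sup>2) * fps_X\<^sup>2) $ 0 \<noteq> 0" by (simp add: fps_X_power_nth)
  then show ?thesis
    by (simp add: odd_cycle_series_def fps_deriv_fps_integral inverse_mult_eq_1')
qed

lemma odd_cycle_series_nth_0 [simp]: "odd_cycle_series r $ 0 = 0"
  by (simp add: odd_cycle_series_def)

text \<open>Up to \<open>fact m\<close>, the power is the exponential generating function of
  permutations with \<open>m\<close> odd cycles, weighted by \<open>r ^ (n - m)\<close>. The
  differential equation of the series turns into the recurrence
  \<open>odd_cycle_number_Suc\<close>.\<close>

lemma odd_cycle_series_power_nth:
  "odd_cycle_series r ^ m $ n =
    fact m * r ^ (n - m) * of_nat (odd_cycle_number n m) / fact n"
proof (induction n arbitrary: m rule: less_induct)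
  case (less n)
  let ?M = "odd_cycle_series r"
  show ?case
  proof (cases n)
    case 0
    then show ?thesis by (auto simp: odd_cycle_number_0_left power_0_left fps_nth_power_0)
  next
    case (Suc l)
    have "(1 - fps_const (r\<^sup>2) * fps_X\<^sup>2) * fps_deriv (?M ^ m) =
        fps_const (of_nat m) * ((1 - fps_const (r\<^sup>2) * fps_X\<^sup>2) * fps_deriv ?M) * ?M ^ (m - 1)"
      by (simp only: fps_deriv_power ac_simps)
    then have "((1 - fps_const (r\<^sup>2) * fps_X\<^sup>2) * fps_deriv (?M ^ m)) $ l =
        of_nat m * (?M ^ (m - 1)) $ l"
      by (simp only: odd_cycle_series_ODE mult_1_right fps_mult_left_const_nth)
    then have "of_nat (Suc l) * ?M ^ m $ Suc l =
        r\<^sup>2 * of_nat (l - 1) * ?M ^ m $ (l - 1) + of_nat m * (?M ^ (m - 1)) $ l"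
      unfolding one_minus_X_power2_times_deriv_nth by (simp add: algebra_simps)
    also have "?M ^ (m - 1) $ l =
        fact (m - 1) * r ^ (l - (m - 1)) * of_nat (odd_cycle_number l (m - 1)) / fact l"
      using less Suc by simp
    also have "?M ^ m $ (l - 1) =
        fact m * r ^ (l - 1 - m) * of_nat (odd_cycle_number (l - 1) m) / fact (l - 1)"
      using less[of "l - 1" m] Suc by simp
    also have "r\<^sup>2 * of_nat (l - 1) *
        (fact m * r ^ (l - 1 - m) * of_nat (odd_cycle_number (l - 1) m) / fact (l - 1)) =
        fact m * r ^ (Suc l - m) * of_nat (l * ((l - 1) * odd_cycle_number (l - 1) m)) / fact l"
    \<comment> \<open>If \<open>l = 0\<close> or \<open>l - 1 < m\<close>, both sides vanish
      whatever the truncated exponents are.\<close>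
    proof (cases "l = 0 \<or> l - 1 < m")
      case True
      then show ?thesis by (auto simp: odd_cycle_number_eq_0)
    next
      case False
      then have "Suc l - m = 2 + (l - 1 - m)" by linarith
      then have "r ^ (Suc l - m) = r\<^sup>2 * r ^ (l - 1 - m)" by (simp only: power_add)
      moreover have "(fact l :: 'a) = of_nat l * fact (l - 1)" using False by (simp add: fact_reduce)
      ultimately show ?thesis using False by (simp add: field_simps)
    qed
    also have "of_nat m * (fact (m - 1) * r ^ (l - (m - 1)) *
        of_nat (odd_cycle_number l (m - 1)) / fact l) =
        fact m * r ^ (Suc l - m) * of_nat (if m = 0 then 0 else odd_cycle_number l (m - 1)) / fact l"
      by (cases m) (simp_all add: fact_reduce)
    finally have "of_nat (Suc l) * ?M ^ m $ Suc l =
        fact m * r ^ (Suc l - m) * of_nat (odd_cycle_number (Suc l) m) / fact l"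
      by (simp add: odd_cycle_number_Suc add_divide_distrib ring_distribs)
    then show ?thesis
      unfolding Suc fact_Suc by (simp add: field_simps del: of_nat_Suc)
  qed
qed

text \<open>By the chain rule and \<open>odd_cycle_series_ODE\<close>, the composition satisfies the
  Riccati equation of \<open>word_series s k\<close>. Both constant terms are 1, so uniqueness
  applies.\<close>

lemma word_series_eq_compose:
  fixes r s :: "'a::field_char_0"
  assumes r: "r\<^sup>2 = 1 - s"
  shows "word_series s k = peak_series s oo (fps_const (of_nat k) * odd_cycle_series r)"
proof -
  let ?a = "fps_const (of_nat k) * odd_cycle_series r"
  let ?V = "peak_series s oo ?a"
  have a0: "?a $ 0 = 0" by simp
  have "fps_deriv ?V = (?V\<^sup>2 - fps_const (1 - s)) * fps_deriv ?a"
    unfolding fps_compose_deriv[OF a0] peak_series_riccati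
    by (simp add: fps_compose_sub_distrib fps_compose_power[OF a0, symmetric] fps_const_compose)
  moreover have "fps_deriv ?a = fps_const (of_nat k) * fps_deriv (odd_cycle_series r)" by simp
  ultimately have "(1 - fps_const (1 - s) * fps_X\<^sup>2) * fps_deriv ?V =
      (?V\<^sup>2 - fps_const (1 - s)) * fps_const (of_nat k) *
      ((1 - fps_const (r\<^sup>2) * fps_X\<^sup>2) * fps_deriv (odd_cycle_series r))"
    by (simp only: r ac_simps)
  then have V: "(1 - fps_const (1 - s) * fps_X\<^sup>2) * fps_deriv ?V =
      of_nat k * (?V\<^sup>2 - fps_const (1 - s))"
    unfolding odd_cycle_series_ODE by (simp add: fps_of_nat mult.commute)
  show ?thesis
    by (rule riccati_unique[OF word_series_ODE V]) (simp add: peak_series_def peak_poly_def)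
qed

lemma word_series_nth_eq_sum_odd_cycle:
  fixes r s :: "'a::field_char_0"
  assumes r: "r\<^sup>2 = 1 - s"
  shows "word_series s k $ n = (\<Sum>m=0..n. 1 / fact n * of_nat (odd_cycle_number n m) *
    r ^ (n - m) * peak_poly m s * of_nat k ^ m)"
  unfolding word_series_eq_compose[OF r] fps_compose_nth
  by (intro sum.cong refl)
    (simp add: power_mult_distrib fps_const_power odd_cycle_series_power_nth peak_series_def)

subsection \<open>Summation over the size of the alphabet\<close>

text \<open>This expands \<open>1 / (1 - x) ^ (n + 1)\<close>, absorbing one factor
  \<open>1 - x\<close> at a time by Pascal's rule.\<close>

lemma fps_binomial_column:
  "(1 - fps_X) ^ Suc n * Abs_fps (\<lambda>k. of_nat ((n + k) choose n)) = (1 :: 'a::comm_ring_1 fps)"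
proof (induction n)
  case 0
  show ?case by (rule fps_ext) (simp add: fps_mult_nth algebra_simps)
next
  case (Suc n)
  have "(1 - fps_X) * Abs_fps (\<lambda>k. of_nat ((Suc n + k) choose Suc n)) =
      (Abs_fps (\<lambda>k. of_nat ((n + k) choose n)) :: 'a fps)"
  proof (rule fps_ext)
    fix k
    show "((1 - fps_X) * Abs_fps (\<lambda>k. of_nat ((Suc n + k) choose Suc n))) $ k =
      (Abs_fps (\<lambda>k. of_nat ((n + k) choose n)) :: 'a fps) $ k"
      by (cases k) (simp_all add: left_diff_distrib binomial_eq_0)
  qed
  moreover have "(1 - fps_X) ^ Suc (Suc n) * Abs_fps (\<lambda>k. of_nat ((Suc n + k) choose Suc n)) =
      (1 - fps_X) ^ Suc n *
        ((1 - fps_X) * (Abs_fps (\<lambda>k. of_nat ((Suc n + k) choose Suc n)) :: 'a fps))"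
    by (simp only: power_Suc ac_simps)
  ultimately show ?case using Suc by (simp only:)
qed

text \<open>The binomial coefficient vanishes for \<open>k \<le> j\<close>, so the sequence is the
  previous column delayed by \<open>j + 1\<close> places.\<close>

lemma fps_binomial_shifted_column:
  assumes "j < n"
  shows "(1 - fps_X) ^ Suc n * Abs_fps (\<lambda>k. of_nat ((k + n - 1 - j) choose n)) =
    (fps_X ^ (j + 1) :: 'a::comm_ring_1 fps)"
proof -
  have "Abs_fps (\<lambda>k. of_nat ((k + n - 1 - j) choose n)) =
      fps_X ^ (j + 1) * (Abs_fps (\<lambda>k. of_nat ((n + k) choose n)) :: 'a fps)"
  proof (rule fps_ext)
    fix k
    have "(k + n - 1 - j) choose n = (if k < j + 1 then 0 else (n + (k - (j + 1))) choose n)"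
      using assms by (auto simp: binomial_eq_0 intro!: arg_cong[where f = "\<lambda>x. x choose n"])
    then show "Abs_fps (\<lambda>k. of_nat ((k + n - 1 - j) choose n)) $ k =
        (fps_X ^ (j + 1) * (Abs_fps (\<lambda>k. of_nat ((n + k) choose n)) :: 'a fps)) $ k"
      unfolding fps_X_power_mult_nth by simp
  qed
  then have "(1 - fps_X) ^ Suc n * Abs_fps (\<lambda>k. of_nat ((k + n - 1 - j) choose n)) =
      fps_X ^ (j + 1) *
        ((1 - fps_X) ^ Suc n * (Abs_fps (\<lambda>k. of_nat ((n + k) choose n)) :: 'a fps))"
    by (simp only: ac_simps)
  then show ?thesis by (simp only: fps_binomial_column mult_1_right)
qed

lemma pk_ides_poly_fps:
  fixes s :: "'a::field_char_0"
  assumes "n \<ge> 1"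
  shows "(1 - fps_X) ^ Suc n * Abs_fps (\<lambda>k. word_series s k $ n) =
    pk_ides_poly n (fps_const s) fps_X"
proof -
  have "Abs_fps (\<lambda>k. word_series s k $ n) = (\<Sum>\<pi>\<in>sym_group n. fps_const (s ^ (pk n \<pi> + 1)) *
      Abs_fps (\<lambda>k. of_nat ((k + n - 1 - ides n \<pi>) choose n)))"
    by (rule fps_ext) (simp add: word_series_nth_eq_sum_perms[OF assms] fps_sum_nth)
  then have "(1 - fps_X) ^ Suc n * Abs_fps (\<lambda>k. word_series s k $ n) =
      (\<Sum>\<pi>\<in>sym_group n. fps_const (s ^ (pk n \<pi> + 1)) *
        ((1 - fps_X) ^ Suc n * Abs_fps (\<lambda>k. of_nat ((k + n - 1 - ides n \<pi>) choose n))))"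
    by (simp only: sum_distrib_left mult.left_commute)
  also have "\<dots> = (\<Sum>\<pi>\<in>sym_group n. fps_const s ^ (pk n \<pi> + 1) * fps_X ^ (ides n \<pi> + 1))"
    by (simp only: fps_binomial_shifted_column[OF ides_less[OF assms]] fps_const_power)
  finally show ?thesis by (simp only: pk_ides_poly_def)
qed

section \<open>Worpitzky's identity and the Eulerian polynomials\<close>

lemma word_series_1_nth: "word_series (1 :: 'a::comm_ring_1) k $ n = of_nat (k ^ n)"
proof -
  have "weight (1 :: 'a) w = 1" for w by (simp add: weight_def)
  then show ?thesis by (simp add: word_series_nth card_words)
qed

text \<open>This is the case \<open>s = 1\<close> of the word count, where every weight is 1;
  inverting the permutations turns \<open>ides\<close> into \<open>des\<close>.\<close>

lemma worpitzky:
  assumes "n \<ge> 1"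
  shows "(of_nat k :: 'a::field_char_0) ^ n =
    (\<Sum>\<sigma>\<in>sym_group n. of_nat ((k + n - 1 - des n \<sigma>) choose n))"
proof -
  have "(of_nat k :: 'a) ^ n = (\<Sum>\<pi>\<in>sym_group n. of_nat ((k + n - 1 - ides n \<pi>) choose n))"
    using word_series_nth_eq_sum_perms[OF assms, of "1 :: 'a" k] by (simp add: word_series_1_nth)
  also have "\<dots> = (\<Sum>\<sigma>\<in>sym_group n. of_nat ((k + n - 1 - ides n (inv \<sigma>)) choose n))"
    unfolding sym_group_def by (rule sum_permutations_inverse)
  also have "\<dots> = (\<Sum>\<sigma>\<in>sym_group n. of_nat ((k + n - 1 - des n \<sigma>) choose n))"
    by (intro sum.cong refl)
      (auto simp: ides_def sym_group_def inv_inv_eq permutes_bij)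
  finally show ?thesis .
qed

lemma eulerian_poly_fps:
  "(1 - fps_X) ^ Suc n * Abs_fps (\<lambda>k. of_nat k ^ n) =
    eulerian_poly n (fps_X :: 'a::field_char_0 fps)"
proof (cases "n = 0")
  case True
  then show ?thesis using fps_binomial_column[of 0, where 'a = 'a] by (simp add: eulerian_poly_def)
next
  case False
  then have n: "n \<ge> 1" by simp
  have "(Abs_fps (\<lambda>k. of_nat k ^ n) :: 'a fps) =
      (\<Sum>\<sigma>\<in>sym_group n. Abs_fps (\<lambda>k. of_nat ((k + n - 1 - des n \<sigma>) choose n)))"
    by (rule fps_ext) (simp add: worpitzky[OF n] fps_sum_nth)
  then have "(1 - fps_X) ^ Suc n * (Abs_fps (\<lambda>k. of_nat k ^ n) :: 'a fps) =
      (\<Sum>\<sigma>\<in>sym_group n. (1 - fps_X) ^ Suc n * Abs_fps (\<lambda>k. of_nat ((k + n - 1 - des n \<sigma>) choose n)))"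
    by (simp only: sum_distrib_left)
  also have "\<dots> = (\<Sum>\<sigma>\<in>sym_group n. fps_X ^ (des n \<sigma> + 1))"
    by (simp only: fps_binomial_shifted_column[OF des_less[OF n]])
  finally show ?thesis using False by (simp add: eulerian_poly_def)
qed

section \<open>From formal power series to values\<close>

lemma fps_of_poly_eulerian_poly:
  "fps_of_poly (eulerian_poly n p) = eulerian_poly n (fps_of_poly p)"
  by (simp add: eulerian_poly_def fps_of_poly_sum fps_of_poly_power fps_of_poly_mult)

lemma poly_eulerian_poly: "poly (eulerian_poly n p) t = eulerian_poly n (poly p t)"
  by (simp add: eulerian_poly_def poly_sum)

lemma fps_of_poly_pk_ides_poly:
  "fps_of_poly (pk_ides_poly n p q) = pk_ides_poly n (fps_of_poly p) (fps_of_poly q)"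
  by (simp add: pk_ides_poly_def fps_of_poly_sum fps_of_poly_power fps_of_poly_mult)

lemma poly_pk_ides_poly: "poly (pk_ides_poly n p q) t = pk_ides_poly n (poly p t) (poly q t)"
  by (simp add: pk_ides_poly_def poly_sum)

theorem theorem3p8:
  fixes n :: nat and s t r :: "'a::field_char_0"
  assumes "n \<ge> 1"
    and "r\<^sup>2 = 1 - s"
  shows "pk_ides_poly n s t =
    1 / fact n * (\<Sum>k=0..n. of_nat (odd_cycle_number n k) * (r * (1 - t)) ^ (n - k)
                              * peak_poly k s * eulerian_poly k t)"
proof -
  \<comment> \<open>\<open>C m\<close> collects the factors free of \<open>t\<close> and of the
    alphabet size.\<close>
  define C where "C m = 1 / fact n * of_nat (odd_cycle_number n m) * r ^ (n - m) * peak_poly m s" for m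
  have "Abs_fps (\<lambda>k. word_series s k $ n) =
      (\<Sum>m=0..n. fps_const (C m) * Abs_fps (\<lambda>k. of_nat k ^ m))"
    by (rule fps_ext)
      (simp add: word_series_nth_eq_sum_odd_cycle[OF assms(2)] fps_sum_nth C_def)
  then have "pk_ides_poly n (fps_const s) fps_X =
      (\<Sum>m=0..n. (1 - fps_X) ^ Suc n * (fps_const (C m) * Abs_fps (\<lambda>k. of_nat k ^ m)))"
    unfolding pk_ides_poly_fps[OF assms(1), symmetric] by (simp only: sum_distrib_left)
  also have "\<dots> = (\<Sum>m=0..n. fps_const (C m) * (1 - fps_X) ^ (n - m) * eulerian_poly m fps_X)"
  proof (intro sum.cong refl)
    fix m assume "m \<in> {0..n}"
    \<comment> \<open>\<open>Suc m\<close> of the factors turn the series of \<open>k ^ m\<close>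
      into the Eulerian polynomial; the other \<open>n - m\<close> remain as the power of
      \<open>1 - t\<close>.\<close>
    then have "Suc n = (n - m) + Suc m" by simp
    then have "(1 - fps_X :: 'a fps) ^ Suc n = (1 - fps_X) ^ (n - m) * (1 - fps_X) ^ Suc m"
      by (simp only: power_add)
    then show "(1 - fps_X) ^ Suc n * (fps_const (C m) * Abs_fps (\<lambda>k. of_nat k ^ m)) =
        fps_const (C m) * (1 - fps_X) ^ (n - m) * eulerian_poly m fps_X"
      unfolding eulerian_poly_fps[symmetric] by (simp only: ac_simps)
  qed
  also have "\<dots> = fps_of_poly
      (\<Sum>m=0..n. [:C m:] * (1 - [:0, 1:]) ^ (n - m) * eulerian_poly m [:0, 1:])"
    by (simp only: fps_of_poly_sum fps_of_poly_mult fps_of_poly_power fps_of_poly_diff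
        fps_of_poly_1 fps_of_poly_const fps_of_poly_fps_X fps_of_poly_eulerian_poly)
  finally have "fps_of_poly (pk_ides_poly n [:s:] [:0, 1:]) = fps_of_poly
      (\<Sum>m=0..n. [:C m:] * (1 - [:0, 1:]) ^ (n - m) * eulerian_poly m [:0, 1:])"
    by (simp only: fps_of_poly_pk_ides_poly fps_of_poly_const fps_of_poly_fps_X)
  \<comment> \<open>Polynomials embed injectively into power series, so the identity is one of
    polynomials and can be evaluated at \<open>t\<close>.\<close>
  then have "poly (pk_ides_poly n [:s:] [:0, 1:]) t =
      poly (\<Sum>m=0..n. [:C m:] * (1 - [:0, 1:]) ^ (n - m) * eulerian_poly m [:0, 1:]) t"
    unfolding fps_of_poly_eq_iff by (rule arg_cong)
  then have "pk_ides_poly n s t = (\<Sum>m=0..n. C m * (1 - t) ^ (n - m) * eulerian_poly m t)"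
    by (simp add: poly_pk_ides_poly poly_sum poly_eulerian_poly mult.assoc)
  then show ?thesis
    by (simp add: C_def sum_distrib_left power_mult_distrib mult_ac)
qed

end
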